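(* For functions $u_1,u_3$ of one real variable, consider the shear flow $$u(x,t)=\bigl(u_1(x_2),\,0,\,u_3(x_1-t\,u_1(x_2))\bigr),\qquad x=(x_1,x_2,x_3)\in\Omega,\ t\ge 0.$$ (i) Let $u_1,u_3\in L^2_{\rm loc}(\mathbb{R})$. Then the shear flow $u$ is a weak solution of the incompressible Euler equations in $\Omega=\mathbb{R}^3$. (ii) Let $u_1,u_3\in L^2(\mathbb{R}/\mathbb{Z})$. Then the shear flow $u$ is a weak solution of the incompressible Euler equations in $\Omega=(\mathbb{R}/\mathbb{Z})^3$. Furthermore, in this case the energy $\int_{(\mathbb{R}/\mathbb{Z})^3}|u(x,t)|^2\,dx$ of this solution is constant in $t$.
   Context: The incompressible Euler equations are $\partial_t u+\nabla\cdot(u\otimes u)=-\nabla p$, $\nabla\cdot u=0$. The domain $\Omega$ is either $\mathbb{R}^3$ or the torus $(\mathbb{R}/\mathbb{Z})^3$ (periodic boundary conditions of period $1$). Functions on $\mathbb{R}/\mathbb{Z}$ are identified with $1$-periodic functions on $\mathbb{R}$. The initial data of the shear flow is $u_0(x)=u(x,0)=(u_1(x_2),0,u_3(x_1))$. Weak solution: a vector field $u\in L^2_{\rm loc}(\Omega\times[0,\infty))$ is a weak solution of the Euler equations with initial data $u_0\in L^2_{\rm loc}(\Omega)$, $\nabla\cdot u_0=0$, if $u$ is divergence free in the sense of distributions in $\Omega\times[0,\infty)$ and if for every divergence-free vector field of test functions $\phi\in C_c^\infty(\Omega\times[0,\infty))$ one has $$\int_{\Omega\times[0,\infty)}\bigl[u\cdot\partial_t\phi+\langle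 u\otimes u,\nabla\phi\rangle\bigr]\,dx\,dt=-\int_\Omega u_0(x)\cdot\phi(x,0)\,dx,$$ where $\langle u\otimes u,\nabla\phi\rangle=\sum_{i,j}u_iu_j\,\partial_{x_j}\phi_i$.
   Formalization: In (i) it is additionally assumed that the shear flow u lies in L²_loc(ℝ³×[0,∞)), as the definition of weak solution requires; this can fail for u₁,u₃ in L²_loc(ℝ), e.g. u₁(s)=s^(-1/4) for s>0 (0 otherwise), u₃(y)=y⁴. *)

theory Defs
  imports "HOL-Analysis.Analysis"
begin

section \<open>Local square integrability and smoothness\<close>

definition L2_loc :: "'a::euclidean_space set \<Rightarrow> ('a \<Rightarrow> 'b::euclidean_space) \<Rightarrow> bool" where
  "L2_loc S f \<longleftrightarrow> set_borel_measurable lebesgue S f \<and>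
     (\<forall>K. compact K \<and> K \<subseteq> S \<longrightarrow> set_integrable lebesgue K (\<lambda>x. (norm (f x))\<^sup>2))"

definition L2_circle :: "(real \<Rightarrow> real) \<Rightarrow> bool" where
  "L2_circle f \<longleftrightarrow> (\<forall>x. f (x + 1) = f x) \<and> f \<in> borel_measurable lebesgue \<and>
     set_integrable lebesgue {0..1} (\<lambda>x. (f x)\<^sup>2)"

text \<open>
  Derivatives are taken within \<open>S\<close>, so that on a closed half-space this is smoothness up to the
  boundary, with one-sided derivatives in the normal direction. The sets used below are convex
  with nonempty interior, hence Frechet derivatives within them are unique.
\<close>

primrec C_on :: "nat \<Rightarrow> 'a::real_normed_vector set \<Rightarrow> ('a \<Rightarrow> 'b::real_normed_vector) \<Rightarrow> bool" where
  "C_on 0 S f \<longleftrightarrow> continuous_on S f"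
| "C_on (Suc k) S f \<longleftrightarrow> f differentiable_on S \<and>
     (\<forall>v. C_on k S (\<lambda>x. frechet_derivative f (at x within S) v))"

definition smooth_on :: "'a::real_normed_vector set \<Rightarrow> ('a \<Rightarrow> 'b::real_normed_vector) \<Rightarrow> bool" where
  "smooth_on S f \<longleftrightarrow> (\<forall>k. C_on k S f)"


section \<open>The two spatial domains\<close>

text \<open>
  A function on the torus is represented by its periodic lift to the whole space, and integrals
  over the torus are integrals over the unit cube.
\<close>

datatype domain = Space | Torus

fun cell :: "domain \<Rightarrow> (real^3) set" where
  "cell Space = UNIV"
| "cell Torus = cbox 0 1"

fun descends :: "domain \<Rightarrow> (real^3 \<Rightarrow> 'b) \<Rightarrow> bool" where
  "descends Space f \<longleftrightarrow> True"
| "descends Torus f \<longleftrightarrow> (\<forall>x i. f (x + axis i 1) = f x)"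

abbreviation spacetime :: "((real^3) \<times> real) set" where
  "spacetime \<equiv> UNIV \<times> {0..}"

text \<open>
  For periodic lifts, local square integrability of the lift is the same as local square
  integrability on the torus.
\<close>

definition L2_loc_space :: "domain \<Rightarrow> (real^3 \<Rightarrow> real^3) \<Rightarrow> bool" where
  "L2_loc_space \<Omega> v \<longleftrightarrow> descends \<Omega> v \<and> L2_loc UNIV v"

definition L2_loc_spacetime :: "domain \<Rightarrow> ((real^3) \<times> real \<Rightarrow> real^3) \<Rightarrow> bool" where
  "L2_loc_spacetime \<Omega> u \<longleftrightarrow> (\<forall>t\<ge>0. descends \<Omega> (\<lambda>x. u (x, t))) \<and> L2_loc spacetime u"

text \<open>
  Test functions. For the torus, the support of the lift is intersected with the closed unit cube:
  this intersection surjects onto the support in the quotient, and it is compact if and only if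
  that support is. The support in space-time may meet the time \<open>0\<close>.
\<close>

definition test_space :: "domain \<Rightarrow> (real^3 \<Rightarrow> 'b::real_normed_vector) \<Rightarrow> bool" where
  "test_space \<Omega> \<psi> \<longleftrightarrow> descends \<Omega> \<psi> \<and> smooth_on UNIV \<psi> \<and>
     compact (closure {x. \<psi> x \<noteq> 0} \<inter> cell \<Omega>)"

definition test_spacetime :: "domain \<Rightarrow> ((real^3) \<times> real \<Rightarrow> 'b::real_normed_vector) \<Rightarrow> bool" where
  "test_spacetime \<Omega> \<phi> \<longleftrightarrow> (\<forall>t\<ge>0. descends \<Omega> (\<lambda>x. \<phi> (x, t))) \<and> smooth_on spacetime \<phi> \<and>
     compact (closure {z \<in> spacetime. \<phi> z \<noteq> 0} \<inter> (cell \<Omega> \<times> UNIV))"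


section \<open>Weak solutions of the Euler equations\<close>

definition pdx :: "3 \<Rightarrow> ((real^3) \<times> real \<Rightarrow> 'b::real_normed_vector) \<Rightarrow> (real^3) \<times> real \<Rightarrow> 'b" where
  "pdx j \<phi> z = frechet_derivative \<phi> (at z within spacetime) (axis j 1, 0)"

definition pdt :: "((real^3) \<times> real \<Rightarrow> 'b::real_normed_vector) \<Rightarrow> (real^3) \<times> real \<Rightarrow> 'b" where
  "pdt \<phi> z = frechet_derivative \<phi> (at z within spacetime) (0, 1)"

definition weakly_div_free_space :: "domain \<Rightarrow> (real^3 \<Rightarrow> real^3) \<Rightarrow> bool" where
  "weakly_div_free_space \<Omega> v \<longleftrightarrow>
     (\<forall>\<psi> :: real^3 \<Rightarrow> real. test_space \<Omega> \<psi> \<longrightarrow>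
        (LINT x:cell \<Omega>|lebesgue. (\<Sum>i\<in>UNIV. v x $ i * frechet_derivative \<psi> (at x) (axis i 1))) = 0)"

definition weakly_div_free_spacetime :: "domain \<Rightarrow> ((real^3) \<times> real \<Rightarrow> real^3) \<Rightarrow> bool" where
  "weakly_div_free_spacetime \<Omega> u \<longleftrightarrow>
     (\<forall>\<psi> :: (real^3) \<times> real \<Rightarrow> real. test_spacetime \<Omega> \<psi> \<longrightarrow>
        (LINT z:cell \<Omega> \<times> {0..}|lebesgue. (\<Sum>i\<in>UNIV. u z $ i * pdx i \<psi> z)) = 0)"

definition div_free_field :: "((real^3) \<times> real \<Rightarrow> real^3) \<Rightarrow> bool" where
  "div_free_field \<phi> \<longleftrightarrow> (\<forall>z\<in>spacetime. (\<Sum>i\<in>UNIV. pdx i \<phi> z $ i) = 0)"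

definition weak_Euler_solution ::
    "domain \<Rightarrow> (real^3 \<Rightarrow> real^3) \<Rightarrow> ((real^3) \<times> real \<Rightarrow> real^3) \<Rightarrow> bool" where
  "weak_Euler_solution \<Omega> u\<^sub>0 u \<longleftrightarrow>
     L2_loc_space \<Omega> u\<^sub>0 \<and> weakly_div_free_space \<Omega> u\<^sub>0 \<and>
     L2_loc_spacetime \<Omega> u \<and> weakly_div_free_spacetime \<Omega> u \<and>
     (\<forall>\<phi> :: (real^3) \<times> real \<Rightarrow> real^3. test_spacetime \<Omega> \<phi> \<and> div_free_field \<phi> \<longrightarrow>
        (LINT z:cell \<Omega> \<times> {0..}|lebesgue.
            u z \<bullet> pdt \<phi> z + (\<Sum>i\<in>UNIV. \<Sum>j\<in>UNIV. u z $ i * u z $ j * pdx j \<phi> z $ i))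
        = - (LINT x:cell \<Omega>|lebesgue. u\<^sub>0 x \<bullet> \<phi> (x, 0)))"


section \<open>The shear flow\<close>

definition shear_data :: "(real \<Rightarrow> real) \<Rightarrow> (real \<Rightarrow> real) \<Rightarrow> real^3 \<Rightarrow> real^3" where
  "shear_data u\<^sub>1 u\<^sub>3 x = vector [u\<^sub>1 (x $ 2), 0, u\<^sub>3 (x $ 1)]"

text \<open>
  On the whole space, local square integrability of the two profiles does not imply that of the
  shear flow: an unbounded \<open>u\<^sub>1\<close> transports the values of \<open>u\<^sub>3\<close> near infinity into a bounded
  region. An example is \<open>u\<^sub>1 s = s powr (-1/4)\<close> for \<open>s > 0\<close>, and \<open>0\<close> otherwise, with \<open>u\<^sub>3 y = y ^ 4\<close>.
  Since weak solutions are locally square integrable by definition, this has to be assumed of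
  the shear flow on the whole space; on the torus it follows from the hypotheses on the profiles.
\<close>

definition shear_flow :: "(real \<Rightarrow> real) \<Rightarrow> (real \<Rightarrow> real) \<Rightarrow> (real^3) \<times> real \<Rightarrow> real^3" where
  "shear_flow u\<^sub>1 u\<^sub>3 = (\<lambda>(x, t). vector [u\<^sub>1 (x $ 2), 0, u\<^sub>3 (x $ 1 - t * u\<^sub>1 (x $ 2))])"

end

(*
  The shear (x, t) |-> (x + t u1(x2) e1, t) preserves Lebesgue measure and turns the shear flow into
  its initial data. In the weak formulation the terms containing a derivative along e3 integrate
  to zero because u is constant along e3. What remains is u . (d/dt + u1 d/dx1) phi; after the shear
  it is a derivative in t alone, with a coefficient constant in t, so Fubini and the fundamental
  theorem of calculus give the initial term. The same shear on the torus conserves the energy.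

  Invariance under shears and the vanishing of integrals of derivatives along a line are obtained
  without splitting coordinates: average the translates along the line over s in [0,1], and exchange
  the integrals. All integrals are taken for Borel representatives of u1 and u3 (periodic ones on
  the torus).
*)

theory Submission
  imports Defs
begin

section \<open>Invariance of integrals under shears\<close>

text \<open>The obstacle is regularity: \<open>u\<^sub>1\<close> is merely measurable, so the shear
  need not even be continuous and no change of variables with a Jacobian applies. What remains is
  that the amount of the shift does not vary along the direction of the shift; in the averaging
  variable s it is an ordinary translation of the line. Nonnegative integrals come first, because
  Tonelli asks for no integrability; null sets and finiteness then follow from the same identity.

  The shear does not map the unit cube to itself. A cell is therefore cut into a slab along the
  direction of shift, where periodicity restores the domain, and a cross-section, which the shear
  preserves. For \<open>Space\<close> the slab is everything, so both domains share one argument.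

  Borel representatives are forced by composition: a Lebesgue measurable profile composed with a
  measurable map need not be measurable.\<close>

definition slab :: "domain \<Rightarrow> 'a::euclidean_space \<Rightarrow> 'a set" where
  "slab \<Omega> e = (case \<Omega> of Space \<Rightarrow> UNIV | Torus \<Rightarrow> {z. 0 \<le> z \<bullet> e \<and> z \<bullet> e \<le> 1})"

definition periodic_along :: "domain \<Rightarrow> 'a::euclidean_space \<Rightarrow> ('a \<Rightarrow> 'b) \<Rightarrow> bool" where
  "periodic_along \<Omega> e h \<longleftrightarrow> (\<Omega> = Torus \<longrightarrow> (\<forall>z. h (z + e) = h z))"

definition constant_along :: "'a::euclidean_space \<Rightarrow> ('a \<Rightarrow> 'b) \<Rightarrow> bool" where
  "constant_along e c \<longleftrightarrow> (\<forall>z s. c (z + s *\<^sub>R e) = c z)"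

lemma constant_alongD:
  assumes "constant_along e c"
  shows "c (z + s *\<^sub>R e) = c z" "c (z + e) = c z"
  using assms spec[OF spec[OF assms[unfolded constant_along_def], of z], of 1]
  by (auto simp: constant_along_def)

lemma slab_borel [measurable]: "slab \<Omega> e \<in> sets borel"
  by (cases \<Omega>) (auto simp: slab_def)

section \<open>Averaging over translates along a line\<close>

lemma nn_integral_lborel_translate:
  fixes h :: "'a::euclidean_space \<Rightarrow> ennreal"
  assumes [measurable]: "h \<in> borel_measurable borel"
  shows "(\<integral>\<^sup>+z. h (z + a) \<partial>lborel) = (\<integral>\<^sup>+z. h z \<partial>lborel)"
proof -
  have "(\<integral>\<^sup>+z. h z \<partial>lborel) = (\<integral>\<^sup>+z. h z \<partial>distr lborel borel ((+) a))"
    by (simp add: lborel_distr_plus)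
  also have "\<dots> = (\<integral>\<^sup>+z. h (a + z) \<partial>lborel)"
    by (subst nn_integral_distr) auto
  finally show ?thesis by (simp add: add.commute)
qed

lemma nn_integral_unit_interval: "(\<integral>\<^sup>+s. indicator {0..1::real} s * (a::ennreal) \<partial>lborel) = a"
  by (simp add: nn_integral_multc)

text \<open>The weight on the unit interval has mass one and all translates have the same integral.
  As \<open>g\<close> may have infinite integral, the identity also serves to prove that an integral
  is finite or that a set is null.\<close>

lemma nn_integral_average:
  fixes g :: "'a::euclidean_space \<Rightarrow> ennreal"
  assumes [measurable]: "g \<in> borel_measurable borel"
  shows "(\<integral>\<^sup>+z. g z \<partial>lborel)
       = (\<integral>\<^sup>+z. \<integral>\<^sup>+s. indicator {0..1::real} s * g (z + s *\<^sub>R e) \<partial>lborel \<partial>lborel)"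
proof -
  let ?J = "indicator {0..1::real} :: real \<Rightarrow> ennreal"
  have "(\<integral>\<^sup>+z. g z \<partial>lborel) = (\<integral>\<^sup>+s. ?J s * (\<integral>\<^sup>+z. g z \<partial>lborel) \<partial>lborel)"
    by (rule nn_integral_unit_interval [symmetric])
  also have "\<dots> = (\<integral>\<^sup>+s. ?J s * (\<integral>\<^sup>+z. g (z + s *\<^sub>R e) \<partial>lborel) \<partial>lborel)"
    by (simp add: nn_integral_lborel_translate)
  also have "\<dots> = (\<integral>\<^sup>+s. \<integral>\<^sup>+z. ?J s * g (z + s *\<^sub>R e) \<partial>lborel \<partial>lborel)"
    by (rule nn_integral_cong) (simp add: nn_integral_cmult)
  also have "\<dots> = (\<integral>\<^sup>+z. \<integral>\<^sup>+s. ?J s * g (z + s *\<^sub>R e) \<partial>lborel \<partial>lborel)"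
    by (rule lborel_pair.Fubini') measurable
  finally show ?thesis .
qed

text \<open>On each line the shift \<open>c z\<close> is a fixed number, so it can be moved from the
  argument of \<open>h\<close> to the weight, which becomes the indicator of a window starting at
  \<open>c z\<close>. Only the length of the window matters, and it is still one.\<close>

lemma nn_integral_shear_space:
  fixes h :: "'a::euclidean_space \<Rightarrow> ennreal" and c :: "'a \<Rightarrow> real"
  assumes [measurable]: "h \<in> borel_measurable borel" "c \<in> borel_measurable borel"
    and c: "constant_along e c"
  shows "(\<integral>\<^sup>+z. h (z + c z *\<^sub>R e) \<partial>lborel) = (\<integral>\<^sup>+z. h z \<partial>lborel)"
proof -
  have c': "c (z + s *\<^sub>R e) = c z" for z s
    using c by (rule constant_alongD)
  let ?J = "indicator {0..1::real} :: real \<Rightarrow> ennreal"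
  have "(\<integral>\<^sup>+z. h (z + c z *\<^sub>R e) \<partial>lborel)
      = (\<integral>\<^sup>+z. \<integral>\<^sup>+s. ?J s * h (z + s *\<^sub>R e + c z *\<^sub>R e) \<partial>lborel \<partial>lborel)"
    by (subst nn_integral_average[where e=e]) (auto simp: c')
  also have "\<dots> = (\<integral>\<^sup>+z. \<integral>\<^sup>+s. ?J (s - c z) * h (z + s *\<^sub>R e) \<partial>lborel \<partial>lborel)"
  proof (rule nn_integral_cong)
    fix z
    show "(\<integral>\<^sup>+s. ?J s * h (z + s *\<^sub>R e + c z *\<^sub>R e) \<partial>lborel)
        = (\<integral>\<^sup>+s. ?J (s - c z) * h (z + s *\<^sub>R e) \<partial>lborel)"
      by (subst nn_integral_lborel_translate[where a="c z", symmetric])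
         (auto simp: algebra_simps)
  qed
  also have "\<dots> = (\<integral>\<^sup>+s. \<integral>\<^sup>+z. ?J (s - c z) * h (z + s *\<^sub>R e) \<partial>lborel \<partial>lborel)"
    by (rule lborel_pair.Fubini'[symmetric]) measurable
  \<comment> \<open>Since \<open>c\<close> is constant along \<open>e\<close>, the window does not
    notice the translation of \<open>z\<close>, which can therefore be undone for each s.\<close>
  also have "\<dots> = (\<integral>\<^sup>+s. \<integral>\<^sup>+z. ?J (s - c z) * h z \<partial>lborel \<partial>lborel)"
  proof (rule nn_integral_cong)
    fix s
    show "(\<integral>\<^sup>+z. ?J (s - c z) * h (z + s *\<^sub>R e) \<partial>lborel) = (\<integral>\<^sup>+z. ?J (s - c z) * h z \<partial>lborel)"
      using nn_integral_lborel_translate[of "\<lambda>z. ?J (s - c z) * h z" "s *\<^sub>R e"] by (simp add: c')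
  qed
  also have "\<dots> = (\<integral>\<^sup>+z. \<integral>\<^sup>+s. ?J (s - c z) * h z \<partial>lborel \<partial>lborel)"
    by (rule lborel_pair.Fubini') measurable
  also have "\<dots> = (\<integral>\<^sup>+z. h z \<partial>lborel)"
  proof (rule nn_integral_cong)
    fix z
    show "(\<integral>\<^sup>+s. ?J (s - c z) * h z \<partial>lborel) = h z"
      using nn_integral_lborel_translate[of "\<lambda>s. ?J s * h z" "- c z"]
      by (simp add: nn_integral_unit_interval)
  qed
  finally show ?thesis .
qed

lemma periodic_shift_int:
  fixes e :: "'a::real_vector"
  assumes "\<And>z. h (z + e) = h z"
  shows "h (z + of_int k *\<^sub>R e) = h z"
proof (induction k arbitrary: z rule: int_induct[where k=0])
  case base
  then show ?case by simp
next
  case (step1 i)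
  have "h (z + of_int (i + 1) *\<^sub>R e) = h ((z + of_int i *\<^sub>R e) + e)"
    by (simp add: algebra_simps)
  then show ?case using step1 assms by simp
next
  case (step2 i)
  have "h (z + of_int (i - 1) *\<^sub>R e) = h (z + of_int (i - 1) *\<^sub>R e + e)"
    using assms by simp
  also have "\<dots> = h (z + of_int i *\<^sub>R e)"
    by (simp add: algebra_simps)
  finally show ?case using step2 by simp
qed

lemma AE_lborel_hyperplane:
  fixes e :: "'a::euclidean_space"
  assumes "e \<in> Basis"
  shows "AE z in lborel. z \<bullet> e \<noteq> r"
proof -
  have "{z. z \<bullet> e = r} \<in> null_sets lebesgue"
    using assms negligible_iff_null_sets negligible_standard_hyperplane by blast
  then have "AE z in lebesgue. z \<notin> {z. z \<bullet> e = r}"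
    by (rule AE_not_in)
  then show ?thesis by (simp add: AE_completion_iff)
qed

text \<open>The integer part of \<open>c\<close> is invisible to the periodic \<open>h\<close>. The
  fractional part r moves the slab [0, 1) to [r, 1 + r); translating the piece beyond 1 back by one
  period fills [0, r), and the original slab is reassembled.\<close>

lemma nn_integral_shear_torus:
  fixes h :: "'a::euclidean_space \<Rightarrow> ennreal" and c :: "'a \<Rightarrow> real"
  assumes [measurable]: "h \<in> borel_measurable borel" "c \<in> borel_measurable borel"
    and e: "e \<in> Basis" and c: "constant_along e c" and h: "\<And>z. h (z + e) = h z"
  shows "(\<integral>\<^sup>+z. indicator (slab Torus e) z * h (z + c z *\<^sub>R e) \<partial>lborel)
       = (\<integral>\<^sup>+z. indicator (slab Torus e) z * h z \<partial>lborel)"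
proof -
  have [simp]: "e \<bullet> e = 1" using e by (simp add: inner_Basis)
  define r where "r z = frac (c z)" for z
  have [measurable]: "r \<in> borel_measurable borel"
    unfolding r_def frac_def by measurable
  have r: "0 \<le> r z" "r z < 1" for z by (auto simp: r_def frac_lt_1)
  have rc: "constant_along e r" using c by (auto simp: constant_along_def r_def)
  note rc' = constant_alongD[OF rc]
  \<comment> \<open>The slab is closed, but only half-open slabs decompose without overlap; the face
    where the coordinate is 1 is null.\<close>
  have slab: "AE z in lborel. indicator (slab Torus e) z * k z
                 = indicator {z. 0 \<le> z \<bullet> e \<and> z \<bullet> e < 1} z * (k z :: ennreal)" for k
    using AE_lborel_hyperplane[OF e, of 1]
    by eventually_elim (auto simp: slab_def indicator_def)
  have hr: "h (z + c z *\<^sub>R e) = h (z + r z *\<^sub>R e)" for z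
  proof -
    have "z + c z *\<^sub>R e = z + r z *\<^sub>R e + of_int \<lfloor>c z\<rfloor> *\<^sub>R e"
      by (simp add: r_def frac_def algebra_simps)
    then show ?thesis by (simp only: periodic_shift_int[of h e, OF h])
  qed
  \<comment> \<open>The cut-off is to the image of the slab under the shear by \<open>r\<close>, so
    that \<open>H (z + r z *\<^sub>R e)\<close> carries the indicator of the original slab and the
    shear invariance on the full space applies.\<close>
  define H where "H z = indicator {z. r z \<le> z \<bullet> e \<and> z \<bullet> e < 1 + r z} z * h z" for z
  have [measurable]: "H \<in> borel_measurable borel" unfolding H_def by measurable
  have "(\<integral>\<^sup>+z. indicator (slab Torus e) z * h (z + c z *\<^sub>R e) \<partial>lborel)
      = (\<integral>\<^sup>+z. indicator {z. 0 \<le> z \<bullet> e \<and> z \<bullet> e < 1} z * h (z + c z *\<^sub>R e) \<partial>lborel)"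
    by (rule nn_integral_cong_AE, rule slab)
  also have "\<dots> = (\<integral>\<^sup>+z. H (z + r z *\<^sub>R e) \<partial>lborel)"
    by (intro nn_integral_cong) (auto simp: H_def hr rc' inner_add_left indicator_def)
  also have "\<dots> = (\<integral>\<^sup>+z. H z \<partial>lborel)"
    by (rule nn_integral_shear_space) (auto intro: rc)
  also have "\<dots> = (\<integral>\<^sup>+z. indicator {z. r z \<le> z \<bullet> e \<and> z \<bullet> e < 1} z * h z
                    + indicator {z. 1 \<le> z \<bullet> e \<and> z \<bullet> e < 1 + r z} z * h z \<partial>lborel)"
  proof (rule nn_integral_cong)
    fix z
    show "H z = indicator {z. r z \<le> z \<bullet> e \<and> z \<bullet> e < 1} z * h z
                    + indicator {z. 1 \<le> z \<bullet> e \<and> z \<bullet> e < 1 + r z} z * h z"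
      using r[of z] by (auto simp: H_def indicator_def)
  qed
  also have "\<dots> = (\<integral>\<^sup>+z. indicator {z. r z \<le> z \<bullet> e \<and> z \<bullet> e < 1} z * h z \<partial>lborel)
                    + (\<integral>\<^sup>+z. indicator {z. 1 \<le> z \<bullet> e \<and> z \<bullet> e < 1 + r z} z * h z \<partial>lborel)"
    by (rule nn_integral_add) auto
  also have "(\<integral>\<^sup>+z. indicator {z. 1 \<le> z \<bullet> e \<and> z \<bullet> e < 1 + r z} z * h z \<partial>lborel)
           = (\<integral>\<^sup>+z. indicator {z. 0 \<le> z \<bullet> e \<and> z \<bullet> e < r z} z * h z \<partial>lborel)"
    by (subst nn_integral_lborel_translate[where a=e, symmetric])
       (auto intro!: nn_integral_cong simp: indicator_def inner_add_left rc' h)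
  also have "(\<integral>\<^sup>+z. indicator {z. r z \<le> z \<bullet> e \<and> z \<bullet> e < 1} z * h z \<partial>lborel) + \<dots>
           = (\<integral>\<^sup>+z. indicator {z. r z \<le> z \<bullet> e \<and> z \<bullet> e < 1} z * h z
                + indicator {z. 0 \<le> z \<bullet> e \<and> z \<bullet> e < r z} z * h z \<partial>lborel)"
    by (rule nn_integral_add[symmetric]) auto
  also have "\<dots> = (\<integral>\<^sup>+z. indicator {z. 0 \<le> z \<bullet> e \<and> z \<bullet> e < 1} z * h z \<partial>lborel)"
  proof (rule nn_integral_cong)
    fix z
    show "indicator {z. r z \<le> z \<bullet> e \<and> z \<bullet> e < 1} z * h z
                + indicator {z. 0 \<le> z \<bullet> e \<and> z \<bullet> e < r z} z * h z
        = indicator {z. 0 \<le> z \<bullet> e \<and> z \<bullet> e < 1} z * h z"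
      using r[of z] by (auto simp: indicator_def)
  qed
  also have "\<dots> = (\<integral>\<^sup>+z. indicator (slab Torus e) z * h z \<partial>lborel)"
    by (rule nn_integral_cong_AE, rule AE_mp[OF slab[of h]]) auto
  finally show ?thesis .
qed

lemma nn_integral_shear:
  fixes h :: "'a::euclidean_space \<Rightarrow> ennreal" and c :: "'a \<Rightarrow> real"
  assumes "h \<in> borel_measurable borel" "c \<in> borel_measurable borel"
    and "e \<in> Basis" "constant_along e c" "periodic_along \<Omega> e h"
  shows "(\<integral>\<^sup>+z. indicator (slab \<Omega> e) z * h (z + c z *\<^sub>R e) \<partial>lborel)
       = (\<integral>\<^sup>+z. indicator (slab \<Omega> e) z * h z \<partial>lborel)"
proof (cases \<Omega>)
  case Space
  then show ?thesis using nn_integral_shear_space[OF assms(1,2,4)] by (simp add: slab_def)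
next
  case Torus
  then show ?thesis using nn_integral_shear_torus[OF assms(1-4)] assms(5)
    by (simp add: periodic_along_def)
qed

lemma
  fixes f :: "'a::euclidean_space \<Rightarrow> real" and c :: "'a \<Rightarrow> real"
  assumes [measurable]: "f \<in> borel_measurable borel" "c \<in> borel_measurable borel"
    and e: "e \<in> Basis" "constant_along e c" and f: "periodic_along \<Omega> e f"
    and int: "set_integrable lborel (slab \<Omega> e) f"
  shows set_integrable_shear: "set_integrable lborel (slab \<Omega> e) (\<lambda>z. f (z + c z *\<^sub>R e))"
    and set_integral_shear:
      "(LINT z:slab \<Omega> e|lborel. f (z + c z *\<^sub>R e)) = (LINT z:slab \<Omega> e|lborel. f z)"
proof -
  \<comment> \<open>The norm as \<open>g\<close> yields integrability; the identity and negation
    yield the positive and negative parts of the integral, as \<open>ennreal\<close> truncates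
    negative reals to zero. The condition \<open>g 0 = 0\<close> lets the indicator pass out of
    \<open>g\<close>.\<close>
  have *: "(\<integral>\<^sup>+z. ennreal (g (indicator (slab \<Omega> e) z *\<^sub>R f (z + c z *\<^sub>R e))) \<partial>lborel)
       = (\<integral>\<^sup>+z. ennreal (g (indicator (slab \<Omega> e) z *\<^sub>R f z)) \<partial>lborel)"
    if [measurable]: "g \<in> borel_measurable borel" and [simp]: "g 0 = 0" for g :: "real \<Rightarrow> real"
  proof -
    have ind: "ennreal (g (indicator S z *\<^sub>R y)) = indicator S z * ennreal (g y)"
      for S and z :: 'a and y by (simp add: indicator_def)
    show ?thesis unfolding ind
      using f by (intro nn_integral_shear) (auto simp: e periodic_along_def)
  qed
  show 1: "set_integrable lborel (slab \<Omega> e) (\<lambda>z. f (z + c z *\<^sub>R e))"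
    using int *[of norm] unfolding set_integrable_def integrable_iff_bounded by auto
  show "(LINT z:slab \<Omega> e|lborel. f (z + c z *\<^sub>R e)) = (LINT z:slab \<Omega> e|lborel. f z)"
    using 1 int *[of "\<lambda>x. x"] *[of "\<lambda>x. - x"]
    unfolding set_integrable_def set_lebesgue_integral_def
    by (simp add: real_lebesgue_integral_def)
qed

text \<open>Along a line in direction \<open>e\<close> the value \<open>z \<bullet> e + c z\<close>
  moves with unit speed, so the preimage of a null set meets every such line in a translated null
  set; averaging over the lines makes it null. This is why changing a profile on a null set changes
  the flow only on a null set.\<close>

lemma AE_lborel_inner_add:
  fixes c :: "'a::euclidean_space \<Rightarrow> real"
  assumes [measurable]: "c \<in> borel_measurable borel"
    and e: "e \<in> Basis" and c: "constant_along e c" and P: "AE y in lborel. P y"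
  shows "AE z in lborel. P (z \<bullet> e + c z)"
proof -
  have [simp]: "e \<bullet> e = 1" using e by (simp add: inner_Basis)
  \<comment> \<open>Members of \<open>null_sets lborel\<close> are Borel, although the exceptional
    set of \<open>P\<close> need not be; so the preimage \<open>M\<close> is measurable.\<close>
  obtain N where N: "N \<in> null_sets lborel" "{y. \<not> P y} \<subseteq> N"
    using P by (auto simp: eventually_ae_filter)
  then have [measurable]: "N \<in> sets borel" by auto
  define M where "M = {z. z \<bullet> e + c z \<in> N}"
  have [measurable]: "M \<in> sets borel" unfolding M_def by measurable
  have "emeasure lborel M = (\<integral>\<^sup>+z. indicator M z \<partial>lborel)" by simp
  also have "\<dots> = (\<integral>\<^sup>+z. \<integral>\<^sup>+s. indicator {0..1} s * indicator M (z + s *\<^sub>R e) \<partial>lborel \<partial>lborel)"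
    by (rule nn_integral_average) simp
  also have "\<dots> \<le> (\<integral>\<^sup>+z. 0 \<partial>(lborel :: 'a measure))"
  proof (rule nn_integral_mono)
    fix z :: 'a
    have "(\<integral>\<^sup>+s. indicator {0..1} s * indicator M (z + s *\<^sub>R e) \<partial>lborel)
       \<le> (\<integral>\<^sup>+s. indicator N (s + (z \<bullet> e + c z)) \<partial>lborel)"
      using c by (intro nn_integral_mono)
        (auto simp: indicator_def M_def inner_add_left algebra_simps constant_along_def)
    also have "\<dots> = (\<integral>\<^sup>+s. indicator N s \<partial>lborel)"
      by (rule nn_integral_lborel_translate) simp
    also have "\<dots> = 0" using N(1) by (simp add: null_setsD1)
    finally show "(\<integral>\<^sup>+s. indicator {0..1} s * indicator M (z + s *\<^sub>R e) \<partial>lborel) \<le> 0" .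
  qed
  finally have "M \<in> null_sets lborel" by (auto intro: null_setsI)
  then show ?thesis
    using N(2) by (intro AE_I'[of M]) (auto simp: M_def)
qed

text \<open>While \<open>z\<close> moves by one unit along \<open>e\<close>, the argument of
  \<open>p\<close> sweeps an interval of length one, wherever \<open>c\<close> has put it. A bound
  on unit windows that is uniform in their position thus controls the average even for unbounded
  \<open>c\<close>.\<close>

lemma nn_integral_profile_finite:
  fixes c :: "'a::euclidean_space \<Rightarrow> real" and p :: "real \<Rightarrow> ennreal"
  assumes [measurable]: "c \<in> borel_measurable borel" "p \<in> borel_measurable borel" "B \<in> sets borel"
    and e: "e \<in> Basis" and c: "constant_along e c" and B: "bounded B" and M: "M < top"
    and p: "\<And>a. (\<integral>\<^sup>+s. indicator {0..1} s * p (a + s) \<partial>lborel) \<le> M"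
  shows "(\<integral>\<^sup>+z. indicator B z * p (z \<bullet> e + c z) \<partial>lborel) < top"
proof -
  have [simp]: "e \<bullet> e = 1" "norm e = 1" using e by (auto simp: inner_Basis)
  obtain r where r: "\<And>z. z \<in> B \<Longrightarrow> norm z \<le> r" using B by (auto simp: bounded_iff)
  have "(\<integral>\<^sup>+z. indicator B z * p (z \<bullet> e + c z) \<partial>lborel)
      = (\<integral>\<^sup>+z. \<integral>\<^sup>+s. indicator {0..1} s * (indicator B (z + s *\<^sub>R e)
             * p ((z + s *\<^sub>R e) \<bullet> e + c (z + s *\<^sub>R e))) \<partial>lborel \<partial>lborel)"
    by (rule nn_integral_average) measurable
  \<comment> \<open>A translate by at most one unit has to land in \<open>B\<close>, hence the
    radius \<open>r + 1\<close>.\<close>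
  also have "\<dots> \<le> (\<integral>\<^sup>+z. indicator (cball (0::'a) (r + 1)) z * M \<partial>lborel)"
  proof (rule nn_integral_mono)
    fix z :: 'a
    have "norm z \<le> r + 1" if "z + s *\<^sub>R e \<in> B" "0 \<le> s" "s \<le> 1" for s
    proof -
      have "norm z \<le> norm (z + s *\<^sub>R e) + norm (s *\<^sub>R e)"
        by (metis add_diff_cancel_right' norm_triangle_ineq4)
      then show ?thesis using r[OF that(1)] that by simp
    qed
    then have "(\<integral>\<^sup>+s. indicator {0..1} s * (indicator B (z + s *\<^sub>R e)
             * p ((z + s *\<^sub>R e) \<bullet> e + c (z + s *\<^sub>R e))) \<partial>lborel)
       \<le> (\<integral>\<^sup>+s. indicator (cball 0 (r + 1)) z * (indicator {0..1} s * p (z \<bullet> e + c z + s)) \<partial>lborel)"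
      using c by (intro nn_integral_mono)
        (auto simp: indicator_def inner_add_left constant_along_def algebra_simps)
    also have "\<dots> = indicator (cball 0 (r + 1)) z * (\<integral>\<^sup>+s. indicator {0..1} s * p (z \<bullet> e + c z + s) \<partial>lborel)"
      by (rule nn_integral_cmult) measurable
    also have "\<dots> \<le> indicator (cball 0 (r + 1)) z * M"
      by (intro mult_left_mono p) simp
    finally show "(\<integral>\<^sup>+s. indicator {0..1} s * (indicator B (z + s *\<^sub>R e)
             * p ((z + s *\<^sub>R e) \<bullet> e + c (z + s *\<^sub>R e))) \<partial>lborel)
      \<le> indicator (cball 0 (r + 1)) z * M" .
  qed
  also have "\<dots> = emeasure lborel (cball (0::'a) (r + 1)) * M"
    by (subst nn_integral_multc) (auto intro!: borel_measurable_indicator)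
  also have "\<dots> < top"
    using M emeasure_bounded_finite[OF bounded_cball, of "0::'a" "r + 1"]
    by (auto simp: ennreal_mult_less_top)
  finally show ?thesis .
qed

text \<open>This is the periodic shear in dimension one, with direction 1 and the constant shift
  \<open>a\<close>.\<close>

lemma nn_integral_unit_period:
  fixes p :: "real \<Rightarrow> ennreal"
  assumes "p \<in> borel_measurable borel" "\<And>y. p (y + 1) = p y"
  shows "(\<integral>\<^sup>+s. indicator {0..1} s * p (a + s) \<partial>lborel) = (\<integral>\<^sup>+s. indicator {0..1} s * p s \<partial>lborel)"
proof -
  have "slab Torus (1::real) = {0..1}" by (auto simp: slab_def)
  then show ?thesis
    using nn_integral_shear_torus[of p "\<lambda>_. a" 1] assms
    by (simp add: constant_along_def add.commute)
qed

text \<open>Average the translates of the integrand over s. As \<open>w\<close> is constant along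
  \<open>e\<close>, the fundamental theorem leaves the difference of \<open>w z * f z\<close>
  between \<open>z + e\<close> and \<open>z\<close>, and its integral vanishes by translation
  invariance. \<open>R\<close> carries the restrictions on the other coordinates.\<close>

lemma set_integral_directional_derivative_eq_0:
  fixes f D w :: "'a::euclidean_space \<Rightarrow> real"
  assumes [measurable]: "R \<in> sets borel" "w \<in> borel_measurable borel"
    and e: "e \<in> Basis" and R: "constant_along e (\<lambda>z. z \<in> R)" and w: "constant_along e w"
    and cont: "continuous_on R f" "continuous_on R D"
    and deriv: "\<And>z s. z \<in> R \<Longrightarrow> ((\<lambda>s. f (z + s *\<^sub>R e)) has_vector_derivative D (z + s *\<^sub>R e)) (at s)"
    and per: "\<And>z. \<Omega> = Torus \<Longrightarrow> z \<in> R \<Longrightarrow> f (z + e) = f z"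
    and int: "set_integrable lborel (slab \<Omega> e \<inter> R) (\<lambda>z. w z * f z)"
      "set_integrable lborel (slab \<Omega> e \<inter> R) (\<lambda>z. w z * D z)"
  shows "(LINT z:slab \<Omega> e \<inter> R|lborel. w z * D z) = 0"
proof -
  have R': "z + s *\<^sub>R e \<in> R \<longleftrightarrow> z \<in> R" "z + e \<in> R \<longleftrightarrow> z \<in> R" for z s
    using constant_alongD[OF R] by auto
  note w' = constant_alongD[OF w]
  define F where "F z = w z * (indicator R z *\<^sub>R f z)" for z
  define G where "G z = w z * (indicator R z *\<^sub>R D z)" for z
  have [measurable]: "(\<lambda>z. indicator R z *\<^sub>R f z) \<in> borel_measurable borel"
    "(\<lambda>z. indicator R z *\<^sub>R D z) \<in> borel_measurable borel"
    by (rule borel_measurable_continuous_on_indicator; use cont in simp)+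
  have [measurable]: "F \<in> borel_measurable borel" "G \<in> borel_measurable borel"
    unfolding F_def G_def by measurable
  \<comment> \<open>Periodicity is given for \<open>f\<close>; uniqueness of derivatives passes it
    on to \<open>D\<close>, where shear invariance requires it.\<close>
  have perD: "D (z + e) = D z" if \<Omega>: "\<Omega> = Torus" and z: "z \<in> R" for z
  proof -
    have "((\<lambda>s. f (z + s *\<^sub>R e)) has_vector_derivative D (z + 0 *\<^sub>R e)) (at 0)"
      by (rule deriv[OF z])
    moreover have "f (z + s *\<^sub>R e) = f (z + e + s *\<^sub>R e)" for s
      using per[OF \<Omega>, of "z + s *\<^sub>R e"] R' z by (simp add: algebra_simps)
    moreover have "((\<lambda>s. f (z + e + s *\<^sub>R e)) has_vector_derivative D (z + e + 0 *\<^sub>R e)) (at 0)"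
      by (rule deriv) (simp add: R' z)
    ultimately show ?thesis by (simp add: vector_derivative_unique_at)
  qed
  have perF: "periodic_along \<Omega> e F" "periodic_along \<Omega> e G"
    using per perD by (auto simp: periodic_along_def F_def G_def R' w' indicator_def)
  have c: "constant_along e (\<lambda>_. s)" for s :: real by (simp add: constant_along_def)
  have "(\<lambda>z. indicator (slab \<Omega> e \<inter> R) z *\<^sub>R (w z * f z)) = (\<lambda>z. indicator (slab \<Omega> e) z *\<^sub>R F z)"
       "(\<lambda>z. indicator (slab \<Omega> e \<inter> R) z *\<^sub>R (w z * D z)) = (\<lambda>z. indicator (slab \<Omega> e) z *\<^sub>R G z)"
    by (auto simp: F_def G_def indicator_def)
  with int have intF: "set_integrable lborel (slab \<Omega> e) F" and intG: "set_integrable lborel (slab \<Omega> e) G"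
    and I: "(LINT z:slab \<Omega> e \<inter> R|lborel. w z * D z) = (LINT z:slab \<Omega> e|lborel. G z)"
    by (simp_all add: set_integrable_def set_lebesgue_integral_def)
  define K where "K s z = indicator {0..1::real} s * (indicator (slab \<Omega> e) z *\<^sub>R G (z + s *\<^sub>R e))" for s z
  have [measurable]: "case_prod K \<in> borel_measurable (lborel \<Otimes>\<^sub>M lborel)"
    unfolding K_def by measurable
  have sG: "set_integrable lborel (slab \<Omega> e) (\<lambda>z. G (z + s *\<^sub>R e))"
    "(LINT z:slab \<Omega> e|lborel. G (z + s *\<^sub>R e)) = (LINT z:slab \<Omega> e|lborel. G z)" for s
    by (intro set_integrable_shear set_integral_shear c e perF intG; simp)+
  have "integrable (lborel \<Otimes>\<^sub>M lborel) (case_prod K)"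
  proof (rule lborel_pair.Fubini_integrable)
    \<comment> \<open>Translation invariance makes the inner norm integral independent of s on the
      unit interval, which gives the integrability that Fubini asks for.\<close>
    have "(\<integral>z. norm (case_prod K (s, z)) \<partial>lborel)
       = indicator {0..1} s * (LINT z:slab \<Omega> e|lborel. \<bar>G z\<bar>)" for s
    proof -
      have "(LINT z:slab \<Omega> e|lborel. \<bar>G (z + s *\<^sub>R e)\<bar>) = (LINT z:slab \<Omega> e|lborel. \<bar>G z\<bar>)"
        using perF intG by (intro set_integral_shear c e set_integrable_abs) (auto simp: periodic_along_def)
      then show ?thesis
        by (simp add: K_def abs_mult set_lebesgue_integral_def)
    qed
    then show "integrable lborel (\<lambda>s. \<integral>z. norm (case_prod K (s, z)) \<partial>lborel)"
      by (simp add: integrable_real_mult_indicator)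
    show "AE s in lborel. integrable lborel (\<lambda>z. case_prod K (s, z))"
      using sG(1) by (auto simp: K_def set_integrable_def)
  qed auto
  then have swap: "(\<integral>z. \<integral>s. K s z \<partial>lborel \<partial>lborel) = (\<integral>s. \<integral>z. K s z \<partial>lborel \<partial>lborel)"
    by (rule lborel_pair.Fubini_integral)
  have "(\<integral>s. \<integral>z. K s z \<partial>lborel \<partial>lborel)
      = (\<integral>s. indicator {0..1::real} s * (LINT z:slab \<Omega> e|lborel. G z) \<partial>lborel)"
    using sG(2) by (simp add: K_def set_lebesgue_integral_def)
  also have "\<dots> = (LINT z:slab \<Omega> e|lborel. G z)" by simp
  finally have "(LINT z:slab \<Omega> e|lborel. G z) = (\<integral>z. \<integral>s. K s z \<partial>lborel \<partial>lborel)"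
    using swap by simp
  also have "\<dots> = (LINT z:slab \<Omega> e|lborel. F (z + 1 *\<^sub>R e) - F z)"
  proof -
    have "(\<integral>s. K s z \<partial>lborel) = indicator (slab \<Omega> e) z *\<^sub>R (F (z + 1 *\<^sub>R e) - F z)" for z
    proof (cases "z \<in> R")
      case True
      have "(\<integral>s. indicator {0..1} s *\<^sub>R D (z + s *\<^sub>R e) \<partial>lborel) = f (z + 1 *\<^sub>R e) - f (z + 0 *\<^sub>R e)"
      proof (rule integral_FTC_Icc)
        show "continuous_on {0..1} (\<lambda>s. D (z + s *\<^sub>R e))"
          by (rule continuous_on_compose2[OF cont(2)]) (auto intro!: continuous_intros simp: R' True)
      qed (simp_all add: has_vector_derivative_at_within[OF deriv[OF True]])
      moreover have "(\<integral>s. K s z \<partial>lborel)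
          = (\<integral>s. (indicator (slab \<Omega> e) z * w z) * (indicator {0..1} s *\<^sub>R D (z + s *\<^sub>R e)) \<partial>lborel)"
        using True by (intro Bochner_Integration.integral_cong) (auto simp: K_def G_def w' R')
      ultimately show ?thesis using True
        by (simp add: F_def w' R' right_diff_distrib mult_ac)
    next
      case False
      then show ?thesis by (simp add: K_def G_def F_def R')
    qed
    then show ?thesis by (simp add: set_lebesgue_integral_def)
  qed
  also have "\<dots> = 0"
    using set_integrable_shear[of F "\<lambda>_. 1" e \<Omega>, OF _ _ e c perF(1) intF]
      set_integral_shear[of F "\<lambda>_. 1" e \<Omega>, OF _ _ e c perF(1) intF] intF
    by (simp add: set_integral_diff)
  finally show ?thesis using I by simp
qed

section \<open>Derivatives of test functions\<close>

text \<open>The hypothesis of \<open>frechet_derivative_unique_within\<close> at every point of \<open>S\<close>.\<close>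

definition axis_accessible :: "'a::euclidean_space set \<Rightarrow> bool" where
  "axis_accessible S \<longleftrightarrow>
     (\<forall>x\<in>S. \<forall>i\<in>Basis. \<forall>r>0. \<exists>d. 0 < \<bar>d\<bar> \<and> \<bar>d\<bar> < r \<and> x + d *\<^sub>R i \<in> S)"

lemma axis_accessible_UNIV: "axis_accessible (UNIV :: 'a::euclidean_space set)"
  unfolding axis_accessible_def
proof (intro ballI allI impI)
  fix x i :: 'a and r :: real
  assume "0 < r"
  then show "\<exists>d. 0 < \<bar>d\<bar> \<and> \<bar>d\<bar> < r \<and> x + d *\<^sub>R i \<in> UNIV"
    by (intro exI[of _ "r / 2"]) auto
qed

lemma axis_accessible_spacetime: "axis_accessible spacetime"
  unfolding axis_accessible_def
proof (intro ballI allI impI)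
  fix x i :: "(real^3) \<times> real" and r :: real
  assume "x \<in> spacetime" "i \<in> Basis" "0 < r"
  then show "\<exists>d. 0 < \<bar>d\<bar> \<and> \<bar>d\<bar> < r \<and> x + d *\<^sub>R i \<in> spacetime"
    by (intro exI[of _ "r / 2"]) (auto simp: Basis_prod_def mem_Times_iff)
qed

section \<open>Derivatives within a set: uniqueness, support, translates, lines\<close>

lemma frechet_derivative_within_eq:
  assumes "axis_accessible S" "x \<in> S" "(f has_derivative f') (at x within S)"
  shows "frechet_derivative f (at x within S) = f'"
proof (rule frechet_derivative_unique_within)
  show "(f has_derivative frechet_derivative f (at x within S)) (at x within S)"
    using assms(3) frechet_derivative_works differentiable_def by blast
qed (use assms in \<open>auto simp: axis_accessible_def\<close>)

text \<open>Near such a point \<open>f\<close> vanishes on \<open>S\<close>. Hence derivatives of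
  test functions inherit the compact support.\<close>

lemma frechet_derivative_within_outside_support:
  assumes "axis_accessible S" "x \<in> S" "x \<notin> closure {z \<in> S. f z \<noteq> 0}"
  shows "frechet_derivative f (at x within S) = (\<lambda>_. 0)"
proof (rule frechet_derivative_within_eq[OF assms(1,2)])
  have "open (- closure {z \<in> S. f z \<noteq> 0})" by auto
  then obtain d where d: "d > 0" "ball x d \<subseteq> - closure {z \<in> S. f z \<noteq> 0}"
    using assms(3) openE[of "- closure {z \<in> S. f z \<noteq> 0}" x] by blast
  show "(f has_derivative (\<lambda>_. 0)) (at x within S)"
  proof (rule has_derivative_transform_within[OF has_derivative_const d(1) assms(2)])
    fix y assume "y \<in> S" "dist y x < d"
    then have "y \<notin> {z \<in> S. f z \<noteq> 0}"
      using d(2) closure_subset[of "{z \<in> S. f z \<noteq> 0}"] by (auto simp: dist_commute subset_iff)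
    then show "0 = f y" using \<open>y \<in> S\<close> by auto
  qed
qed

text \<open>As the translate of \<open>S\<close> lies in \<open>S\<close>, the derivative at
  \<open>z + a\<close> can be restricted to it and pulled back by the chain rule; uniqueness within
  \<open>S\<close> identifies the result. This makes derivatives of periodic test functions
  periodic.\<close>

lemma frechet_derivative_within_translate:
  assumes S: "axis_accessible S" "\<And>z. z \<in> S \<Longrightarrow> z + a \<in> S"
    and f: "f differentiable_on S" "\<And>z. z \<in> S \<Longrightarrow> f (z + a) = f z" and z: "z \<in> S"
  shows "frechet_derivative f (at (z + a) within S) = frechet_derivative f (at z within S)"
proof (rule sym, rule frechet_derivative_within_eq[OF S(1) z])
  let ?D = "frechet_derivative f (at (z + a) within S)"
  have "(f has_derivative ?D) (at (z + a) within S)"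
    using f(1) S(2)[OF z] by (simp add: differentiable_on_def frechet_derivative_works)
  then have "(f has_derivative ?D) (at (z + a) within (\<lambda>y. y + a) ` S)"
    by (rule has_derivative_subset) (use S(2) in auto)
  moreover have "((\<lambda>y. y + a) has_derivative (\<lambda>h. h)) (at z within S)"
    by (auto intro!: derivative_eq_intros)
  ultimately have "((\<lambda>y. f (y + a)) has_derivative ?D) (at z within S)"
    using has_derivative_in_compose by blast
  then show "(f has_derivative ?D) (at z within S)"
    by (rule has_derivative_transform[OF z, rotated]) (use f(2) in auto)
qed

text \<open>The parameter set \<open>T\<close> is there because a line may leave \<open>S\<close>:
  spatial lines use all reals, flow lines only times from 0 on, with a one-sided derivative at the
  start.\<close>

lemma has_vector_derivative_along_line:
  assumes f: "f differentiable_on S" and s: "s \<in> T" and T: "\<And>s. s \<in> T \<Longrightarrow> z + s *\<^sub>R v \<in> S"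
  shows "((\<lambda>s. f (z + s *\<^sub>R v)) has_vector_derivative
            frechet_derivative f (at (z + s *\<^sub>R v) within S) v) (at s within T)"
proof -
  let ?D = "frechet_derivative f (at (z + s *\<^sub>R v) within S)"
  have D: "(f has_derivative ?D) (at (z + s *\<^sub>R v) within S)"
    using f T[OF s] by (simp add: differentiable_on_def frechet_derivative_works)
  then have "(f has_derivative ?D) (at (z + s *\<^sub>R v) within (\<lambda>s. z + s *\<^sub>R v) ` T)"
    by (rule has_derivative_subset) (use T in auto)
  moreover have "((\<lambda>s. z + s *\<^sub>R v) has_derivative (\<lambda>h. h *\<^sub>R v)) (at s within T)"
    by (auto intro!: derivative_eq_intros)
  ultimately have "((\<lambda>s. f (z + s *\<^sub>R v)) has_derivative (\<lambda>h. ?D (h *\<^sub>R v))) (at s within T)"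
    using has_derivative_in_compose by blast
  moreover have "?D (h *\<^sub>R v) = h *\<^sub>R ?D v" for h
    using D has_derivative_linear linear_scale by blast
  ultimately show ?thesis by (simp add: has_vector_derivative_def)
qed

lemma smooth_onD:
  assumes "smooth_on S f"
  shows "f differentiable_on S" "continuous_on S f"
    "continuous_on S (\<lambda>x. frechet_derivative f (at x within S) v)"
proof -
  have "C_on (Suc 0) S f" using assms by (simp add: smooth_on_def)
  then show 1: "f differentiable_on S" and "continuous_on S (\<lambda>x. frechet_derivative f (at x within S) v)"
    by auto
  show "continuous_on S f" using 1 by (rule differentiable_imp_continuous_on)
qed

text \<open>Measurability is Borel and on the whole space, so that \<open>w\<close> can be composed
  with shears.\<close>

definition loc_integrable :: "'a::euclidean_space set \<Rightarrow> ('a \<Rightarrow> real) \<Rightarrow> bool" where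
  "loc_integrable S w \<longleftrightarrow> w \<in> borel_measurable borel \<and>
     (\<forall>K. compact K \<and> K \<subseteq> S \<longrightarrow> set_integrable lborel K w)"

lemma set_integrable_times_compact_support:
  fixes w g :: "'a::euclidean_space \<Rightarrow> real"
  assumes w: "loc_integrable S w" and Q: "Q \<in> sets borel" "Q \<subseteq> S" and K: "compact K" "K \<subseteq> Q"
    and g: "continuous_on Q g" "\<And>z. z \<in> Q - K \<Longrightarrow> g z = 0"
  shows "set_integrable lborel Q (\<lambda>z. w z * g z)"
proof -
  have [measurable]: "w \<in> borel_measurable borel" using w by (simp add: loc_integrable_def)
  have [measurable]: "(\<lambda>z. indicator Q z *\<^sub>R g z) \<in> borel_measurable borel"
    by (rule borel_measurable_continuous_on_indicator[OF Q(1) g(1)])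
  have "bounded (g ` K)"
    using K g(1) by (meson compact_continuous_image compact_imp_bounded continuous_on_subset)
  then obtain B where B: "\<And>z. z \<in> K \<Longrightarrow> \<bar>g z\<bar> \<le> B" by (auto simp: bounded_iff)
  have wK: "set_integrable lborel K w" using w K Q by (auto simp: loc_integrable_def)
  then have "integrable lborel (\<lambda>z. B * (indicator K z *\<^sub>R w z))"
    by (auto simp: set_integrable_def)
  then show ?thesis
    unfolding set_integrable_def
  proof (rule Bochner_Integration.integrable_bound)
    have "(\<lambda>z. w z * (indicator Q z *\<^sub>R g z)) \<in> borel_measurable lborel" by measurable
    then show "(\<lambda>z. indicator Q z *\<^sub>R (w z * g z)) \<in> borel_measurable lborel"
      by (simp add: mult_ac)
    show "AE z in lborel. norm (indicator Q z *\<^sub>R (w z * g z)) \<le> norm (B * (indicator K z *\<^sub>R w z))"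
    proof (intro AE_I2)
      fix z
      show "norm (indicator Q z *\<^sub>R (w z * g z)) \<le> norm (B * (indicator K z *\<^sub>R w z))"
      proof (cases "z \<in> K")
        case True
        then have "\<bar>w z\<bar> * \<bar>g z\<bar> \<le> \<bar>B\<bar> * \<bar>w z\<bar>"
          using B[of z] by (subst mult.commute, intro mult_right_mono) auto
        with True K(2) show ?thesis by (auto simp: abs_mult)
      next
        case False
        then show ?thesis using g(2)[of z] by (auto simp: indicator_def)
      qed
    qed
  qed
qed

text \<open>On the torus the support of a periodic lift is in general not compact; only its part
  over the cell \<open>Q\<close> is, and there the continuous factor is bounded. Pairing with
  \<open>k\<close> reduces vector-valued test functions to scalar components.\<close>

lemma
  fixes \<phi> :: "'a::euclidean_space \<Rightarrow> 'b::euclidean_space"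
  assumes S: "axis_accessible S" and \<phi>: "smooth_on S \<phi>"
    and Q: "Q \<in> sets borel" "Q \<subseteq> S" and K: "compact (closure {z \<in> S. \<phi> z \<noteq> 0} \<inter> Q)"
    and w: "loc_integrable S w"
  shows set_integrable_times_test: "set_integrable lborel Q (\<lambda>z. w z * (\<phi> z \<bullet> k))"
    and set_integrable_times_test_derivative:
      "set_integrable lborel Q (\<lambda>z. w z * (frechet_derivative \<phi> (at z within S) v \<bullet> k))"
proof -
  note D = smooth_onD[OF \<phi>]
  show "set_integrable lborel Q (\<lambda>z. w z * (\<phi> z \<bullet> k))"
  proof (rule set_integrable_times_compact_support[OF w Q K])
    show "continuous_on Q (\<lambda>z. \<phi> z \<bullet> k)"
      using D(2) Q(2) by (intro continuous_intros) (rule continuous_on_subset)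
    fix z assume "z \<in> Q - closure {z \<in> S. \<phi> z \<noteq> 0} \<inter> Q"
    then show "\<phi> z \<bullet> k = 0"
      using Q(2) closure_subset[of "{z \<in> S. \<phi> z \<noteq> 0}"] by auto
  qed auto
  show "set_integrable lborel Q (\<lambda>z. w z * (frechet_derivative \<phi> (at z within S) v \<bullet> k))"
  proof (rule set_integrable_times_compact_support[OF w Q K])
    show "continuous_on Q (\<lambda>z. frechet_derivative \<phi> (at z within S) v \<bullet> k)"
      using D(3) Q(2) by (intro continuous_intros) (rule continuous_on_subset)
    fix z assume "z \<in> Q - closure {z \<in> S. \<phi> z \<noteq> 0} \<inter> Q"
    then show "frechet_derivative \<phi> (at z within S) v \<bullet> k = 0"
      using Q(2) by (subst frechet_derivative_within_outside_support[OF S]) auto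
  qed auto
qed

text \<open>Lines in direction \<open>e\<close> through \<open>R\<close> stay in \<open>S\<close>,
  so along them the derivative within \<open>S\<close> is two-sided, even at time 0 when
  \<open>e\<close> is a spatial direction.\<close>

lemma set_integral_test_derivative_eq_0:
  fixes \<phi> :: "'a::euclidean_space \<Rightarrow> 'b::euclidean_space"
  assumes S: "axis_accessible S" and \<phi>: "smooth_on S \<phi>"
    and Q: "Q = slab \<Omega> e \<inter> R" and R: "R \<in> sets borel" "R \<subseteq> S" "constant_along e (\<lambda>z. z \<in> R)"
    and e: "e \<in> Basis"
    and K: "compact (closure {z \<in> S. \<phi> z \<noteq> 0} \<inter> Q)"
    and per: "\<And>z. \<Omega> = Torus \<Longrightarrow> z \<in> S \<Longrightarrow> \<phi> (z + e) = \<phi> z"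
    and w: "loc_integrable S w" "constant_along e w"
  shows "(LINT z:Q|lborel. w z * (frechet_derivative \<phi> (at z within S) e \<bullet> k)) = 0"
proof -
  note D = smooth_onD[OF \<phi>]
  have Q': "slab \<Omega> e \<inter> R \<in> sets borel" "slab \<Omega> e \<inter> R \<subseteq> S" using R by auto
  note K' = K[unfolded Q]
  have R': "z + s *\<^sub>R e \<in> R \<longleftrightarrow> z \<in> R" for z s using R(3) by (auto simp: constant_along_def)
  show ?thesis
    unfolding Q
  proof (rule set_integral_directional_derivative_eq_0[where f = "\<lambda>z. \<phi> z \<bullet> k"])
    show "continuous_on R (\<lambda>z. \<phi> z \<bullet> k)"
      using D(2) R(2) by (intro continuous_intros) (rule continuous_on_subset)
    show "continuous_on R (\<lambda>z. frechet_derivative \<phi> (at z within S) e \<bullet> k)"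
      using D(3) R(2) by (intro continuous_intros) (rule continuous_on_subset)
    show "w \<in> borel_measurable borel" using w by (simp add: loc_integrable_def)
    fix z s assume z: "z \<in> R"
    have "((\<lambda>s. \<phi> (z + s *\<^sub>R e)) has_vector_derivative
            frechet_derivative \<phi> (at (z + s *\<^sub>R e) within S) e) (at s)"
      by (rule has_vector_derivative_along_line[OF D(1), of _ UNIV]) (use z R' R(2) in auto)
    then show "((\<lambda>s. \<phi> (z + s *\<^sub>R e) \<bullet> k) has_vector_derivative
            frechet_derivative \<phi> (at (z + s *\<^sub>R e) within S) e \<bullet> k) (at s)"
      by (rule bounded_linear.has_vector_derivative[OF bounded_linear_inner_left])
  next
    show "set_integrable lborel (slab \<Omega> e \<inter> R) (\<lambda>z. w z * (\<phi> z \<bullet> k))"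
      by (rule set_integrable_times_test[OF S \<phi> Q' K' w(1)])
    show "set_integrable lborel (slab \<Omega> e \<inter> R)
            (\<lambda>z. w z * (frechet_derivative \<phi> (at z within S) e \<bullet> k))"
      by (rule set_integrable_times_test_derivative[OF S \<phi> Q' K' w(1)])
    show "\<phi> (z + e) \<bullet> k = \<phi> z \<bullet> k" if "\<Omega> = Torus" "z \<in> R" for z
      using per[of z] that R(2) by auto
  qed (use R e w in auto)
qed

section \<open>Integration along the flow\<close>

text \<open>This is the factor of the cell that is invariant under motion along
  \<open>axis i 1\<close>; the other factor is the slab in that direction.\<close>

definition cross_section :: "domain \<Rightarrow> 3 \<Rightarrow> (real^3) set" where
  "cross_section \<Omega> i = {x. \<Omega> = Torus \<longrightarrow> (\<forall>j. j \<noteq> i \<longrightarrow> 0 \<le> x $ j \<and> x $ j \<le> 1)}"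

lemma cell_eq: "cell \<Omega> = slab \<Omega> (axis i 1) \<inter> cross_section \<Omega> i"
  by (cases \<Omega>) (auto simp: slab_def cross_section_def mem_box_cart inner_axis)

lemma cell_times_eq:
  "cell \<Omega> \<times> {0..} = slab \<Omega> (axis i 1, 0::real) \<inter> (cross_section \<Omega> i \<times> {0..})"
  by (cases \<Omega>) (auto simp: slab_def cross_section_def mem_box_cart inner_axis)

lemma cross_section_closed: "closed (cross_section \<Omega> i)"
proof -
  have "cross_section \<Omega> i = (\<Inter>j\<in>{j. \<Omega> = Torus \<and> j \<noteq> i}. {x. 0 \<le> x $ j} \<inter> {x. x $ j \<le> 1})"
    by (auto simp: cross_section_def)
  also have "closed \<dots>"
    by (intro closed_INT ballI closed_Int closed_Collect_le continuous_intros)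
  finally show ?thesis .
qed

lemma cross_section_borel [measurable]: "cross_section \<Omega> i \<in> sets borel"
  by (rule borel_closed[OF cross_section_closed])

lemma cross_section_times_borel: "cross_section \<Omega> i \<times> {0::real..} \<in> sets borel"
  by (intro borel_closed closed_Times cross_section_closed) auto

lemma cross_section_constant:
  "constant_along (axis i 1) (\<lambda>x. x \<in> cross_section \<Omega> i)"
  "constant_along (axis i 1, 0) (\<lambda>z. z \<in> cross_section \<Omega> i \<times> {0::real..})"
  by (auto simp: constant_along_def cross_section_def axis_def)

lemma cell_borel [measurable]: "cell \<Omega> \<in> sets borel"
  by (cases \<Omega>) auto

lemma cell_times_borel: "cell \<Omega> \<times> {0::real..} \<in> sets borel"
  by (cases \<Omega>) (auto intro!: borel_closed closed_Times)

lemma axis_Basis: "axis i (1::real) \<in> Basis" "(axis i (1::real), 0::real) \<in> Basis"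
  by (auto simp: Basis_prod_def axis_in_Basis_iff)

lemma vec_nth_borel [measurable]: "(\<lambda>x::real^3. x $ i) \<in> borel_measurable borel"
  by (intro borel_measurable_continuous_onI continuous_intros)

lemma fst_snd_borel [measurable]:
  "fst \<in> borel_measurable (borel :: ((real^3) \<times> real) measure)"
  "snd \<in> borel_measurable (borel :: ((real^3) \<times> real) measure)"
  by (auto intro!: borel_measurable_continuous_onI continuous_intros)

lemma closed_spacetime: "closed spacetime"
  by (intro closed_Times) auto

lemma closure_support_spacetime:
  "closure {z \<in> spacetime. \<phi> z \<noteq> 0} \<inter> (cell \<Omega> \<times> UNIV)
     = closure {z \<in> spacetime. \<phi> z \<noteq> 0} \<inter> (cell \<Omega> \<times> {0..})"
  using closure_minimal[OF _ closed_spacetime, of "{z \<in> spacetime. \<phi> z \<noteq> 0}"] by auto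

lemma test_spacetimeD:
  assumes "test_spacetime \<Omega> \<phi>"
  shows "smooth_on spacetime \<phi>"
    and "compact (closure {z \<in> spacetime. \<phi> z \<noteq> 0} \<inter> (cell \<Omega> \<times> {0..}))"
    and "\<And>z. \<Omega> = Torus \<Longrightarrow> z \<in> spacetime \<Longrightarrow> \<phi> (z + (axis i 1, 0)) = \<phi> z"
  using assms by (auto simp: test_spacetime_def closure_support_spacetime)

lemma descends_frac:
  assumes "descends Torus f"
  shows "f (\<chi> i. frac (x $ i)) = f x"
proof -
  have per: "f (y + of_int k *\<^sub>R axis i 1) = f y" for y k i
    using assms by (intro periodic_shift_int) auto
  have "x = (\<chi> i. frac (x $ i)) + of_int \<lfloor>x $ 1\<rfloor> *\<^sub>R axis 1 1
      + of_int \<lfloor>x $ 2\<rfloor> *\<^sub>R axis 2 1 + of_int \<lfloor>x $ 3\<rfloor> *\<^sub>R axis 3 1"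
    by (simp add: vec_eq_iff forall_3 frac_def axis_def)
  then show ?thesis by (metis per)
qed

text \<open>On the torus, compactness bounds the times of the support over the unit cube only;
  periodicity carries the vanishing at later times to every point, through its fractional
  parts.\<close>

lemma test_spacetime_bounded_time:
  assumes \<phi>: "test_spacetime \<Omega> \<phi>"
  obtains T where "0 \<le> T" "\<And>x t. T < t \<Longrightarrow> \<phi> (x, t) = 0"
proof -
  let ?K = "closure {z \<in> spacetime. \<phi> z \<noteq> 0} \<inter> (cell \<Omega> \<times> {0..})"
  have "bounded ?K" using test_spacetimeD(2)[OF \<phi>] by (rule compact_imp_bounded)
  then obtain T where T: "\<And>z. z \<in> ?K \<Longrightarrow> norm z \<le> T" by (auto simp: bounded_iff)
  have *: "\<phi> (x, t) = 0" if "x \<in> cell \<Omega>" "max 0 T < t" for x t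
  proof (rule ccontr)
    assume "\<phi> (x, t) \<noteq> 0"
    then have "(x, t) \<in> {z \<in> spacetime. \<phi> z \<noteq> 0}" using that by auto
    then have "(x, t) \<in> ?K" using that closure_subset by fastforce
    then have "norm (x, t) \<le> T" by (rule T)
    moreover have "t \<le> norm (x, t)" using norm_snd_le[of t x] by simp
    ultimately show False using that by simp
  qed
  have "\<phi> (x, t) = 0" if t: "max 0 T < t" for x t
  proof (cases \<Omega>)
    case Space
    then show ?thesis using * t by simp
  next
    case Torus
    have "\<phi> (x, t) = \<phi> (\<chi> i. frac (x $ i), t)"
      using descends_frac[of "\<lambda>x. \<phi> (x, t)" x] \<phi> t Torus by (simp add: test_spacetime_def)
    also have "\<dots> = 0"
      by (rule *[OF _ t]) (auto simp: Torus mem_box_cart less_imp_le[OF frac_lt_1])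
    finally show ?thesis .
  qed
  then show thesis by (intro that[of "max 0 T"]) auto
qed

text \<open>The integrand is the derivative of \<open>\<phi>\<close> along a line of velocity
  \<open>v\<close>, paired with \<open>k\<close>. At late times \<open>\<phi>\<close> vanishes, so
  the fundamental theorem leaves the value at time 0.\<close>

lemma integral_along_flow_line:
  fixes \<phi> :: "(real^3) \<times> real \<Rightarrow> 'b::euclidean_space"
  assumes \<phi>: "test_spacetime \<Omega> \<phi>"
  shows "(LINT t:{0..}|lborel. (pdt \<phi> (x + (t * a) *\<^sub>R axis i 1, t)
            + a *\<^sub>R pdx i \<phi> (x + (t * a) *\<^sub>R axis i 1, t)) \<bullet> k) = - (\<phi> (x, 0) \<bullet> k)"
proof -
  note D = smooth_onD[OF test_spacetimeD(1)[OF \<phi>]]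
  obtain T where T: "0 \<le> T" "\<And>x t. T < t \<Longrightarrow> \<phi> (x, t) = 0"
    by (rule test_spacetime_bounded_time[OF \<phi>]) blast
  define v where "v = (a *\<^sub>R axis i (1::real), 1::real)"
  define p where "p t = (x, 0) + t *\<^sub>R v" for t :: real
  have p: "p t = (x + (t * a) *\<^sub>R axis i 1, t)" for t by (simp add: p_def v_def)
  have pS: "p t \<in> spacetime" if "0 \<le> t" for t using that by (simp add: p)
  let ?D = "\<lambda>z. frechet_derivative \<phi> (at z within spacetime)"
  have lin: "pdt \<phi> z + a *\<^sub>R pdx i \<phi> z = ?D z v" if "z \<in> spacetime" for z
  proof -
    have "linear (?D z)"
      using D(1) that has_derivative_linear
      by (force simp: differentiable_on_def frechet_derivative_works)
    moreover have "v = (0, 1) + a *\<^sub>R (axis i 1, 0)" by (simp add: v_def)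
    ultimately show ?thesis
      by (simp add: linear_add linear_scale pdt_def pdx_def del: scaleR_Pair add_Pair)
  qed
  have out: "?D (p t) v = 0" if "T < t" for t
  proof (subst frechet_derivative_within_outside_support[OF axis_accessible_spacetime])
    show "p t \<in> spacetime" using pS that T(1) by simp
    have "closure {z \<in> spacetime. \<phi> z \<noteq> 0} \<subseteq> UNIV \<times> {..T}"
      using T(2) by (intro closure_minimal closed_Times) (auto simp: not_less[symmetric])
    then show "p t \<notin> closure {z \<in> spacetime. \<phi> z \<noteq> 0}" using that by (auto simp: p)
  qed simp
  \<comment> \<open>Vanishing is known at times strictly beyond \<open>T\<close>, hence the endpoint
    \<open>T + 1\<close>, where the upper boundary term is zero.\<close>
  have "(LINT t:{0..}|lborel. (pdt \<phi> (p t) + a *\<^sub>R pdx i \<phi> (p t)) \<bullet> k)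
      = (\<integral>t. indicator {0..T + 1} t *\<^sub>R (?D (p t) v \<bullet> k) \<partial>lborel)"
    unfolding set_lebesgue_integral_def
    by (intro Bochner_Integration.integral_cong)
       (use T(1) out in \<open>auto simp: indicator_def lin pS\<close>)
  also have "\<dots> = \<phi> (p (T + 1)) \<bullet> k - \<phi> (p 0) \<bullet> k"
  proof (rule integral_FTC_Icc)
    show "0 \<le> T + 1" using T(1) by simp
    show "continuous_on {0..T + 1} (\<lambda>t. ?D (p t) v \<bullet> k)"
      by (intro continuous_intros continuous_on_compose2[OF D(3)])
         (auto simp: p intro!: continuous_intros)
    fix t :: real assume t: "0 \<le> t" "t \<le> T + 1"
    have "((\<lambda>t. \<phi> (p t)) has_vector_derivative ?D (p t) v) (at t within {0..T + 1})"
      unfolding p_def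
      by (rule has_vector_derivative_along_line[OF D(1)]) (use t in \<open>auto simp: v_def\<close>)
    then show "((\<lambda>t. \<phi> (p t) \<bullet> k) has_vector_derivative ?D (p t) v \<bullet> k) (at t within {0..T + 1})"
      by (rule bounded_linear.has_vector_derivative[OF bounded_linear_inner_left])
  qed
  also have "\<dots> = - (\<phi> (x, 0) \<bullet> k)" using T(2) by (simp add: p)
  finally show ?thesis by (simp add: p)
qed

text \<open>This treats one velocity component \<open>w\<close>, with \<open>c\<close> in the role
  of \<open>u\<^sub>1\<close>. After the shear the factor \<open>w\<close> is free of t, and the
  t-integral runs along a flow line. \<open>wc\<close> is assumed separately since a product of
  locally integrable functions need not be locally integrable; for the flow it comes from square
  integrability.\<close>

lemma
  fixes \<phi> :: "(real^3) \<times> real \<Rightarrow> 'b::euclidean_space" and c :: "real^3 \<Rightarrow> real"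
    and w :: "(real^3) \<times> real \<Rightarrow> real"
  assumes \<phi>: "test_spacetime \<Omega> \<phi>"
    and c[measurable]: "c \<in> borel_measurable borel" and c_const: "constant_along (axis i 1) c"
    and w: "loc_integrable spacetime w" and wc: "loc_integrable spacetime (\<lambda>z. w z * c (fst z))"
    and w_per: "periodic_along \<Omega> (axis i 1, 0) w"
    and flow: "\<And>x t. w (x + (t * c x) *\<^sub>R axis i 1, t) = w\<^sub>0 x"
  shows set_integrable_transport: "set_integrable lborel (cell \<Omega> \<times> {0..})
          (\<lambda>z. w z * (pdt \<phi> z \<bullet> k) + w z * c (fst z) * (pdx i \<phi> z \<bullet> k))"
    and set_integrable_initial: "set_integrable lborel (cell \<Omega>) (\<lambda>x. w\<^sub>0 x * (\<phi> (x, 0) \<bullet> k))"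
    and set_integral_transport:
      "(LINT z:cell \<Omega> \<times> {0..}|lborel. w z * (pdt \<phi> z \<bullet> k) + w z * c (fst z) * (pdx i \<phi> z \<bullet> k))
       = - (LINT x:cell \<Omega>|lborel. w\<^sub>0 x * (\<phi> (x, 0) \<bullet> k))"
proof -
  note D = smooth_onD[OF test_spacetimeD(1)[OF \<phi>]]
  let ?e = "(axis i 1, 0) :: (real^3) \<times> real"
  let ?R = "cross_section \<Omega> i \<times> {0::real..}"
  let ?Q = "cell \<Omega> \<times> {0::real..}"
  have [measurable]: "w \<in> borel_measurable borel" using w by (simp add: loc_integrable_def)
  have [measurable]: "?R \<in> sets borel" by (rule cross_section_times_borel)
  have [measurable]: "(\<lambda>z. indicator ?R z *\<^sub>R pdt \<phi> z) \<in> borel_measurable borel"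
     "(\<lambda>z. indicator ?R z *\<^sub>R pdx i \<phi> z) \<in> borel_measurable borel"
    unfolding pdt_def pdx_def
    by (rule borel_measurable_continuous_on_indicator,
        simp, rule continuous_on_subset[OF D(3)], auto)+
  \<comment> \<open>The derivatives are known to be continuous on \<open>spacetime\<close> only.
    Cutting them off to \<open>?R\<close>, which the shear preserves, makes \<open>f\<close> Borel
    on the whole space and turns the integral over the cell into one over the slab.\<close>
  define f where "f z = w z * ((indicator ?R z *\<^sub>R pdt \<phi> z) \<bullet> k)
      + w z * c (fst z) * ((indicator ?R z *\<^sub>R pdx i \<phi> z) \<bullet> k)" for z
  have f[measurable]: "f \<in> borel_measurable borel" unfolding f_def by measurable
  have trans: "frechet_derivative \<phi> (at (z + ?e) within spacetime) = frechet_derivative \<phi> (at z within spacetime)"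
    if "\<Omega> = Torus" "z \<in> spacetime" for z
    by (rule frechet_derivative_within_translate[OF axis_accessible_spacetime _ D(1)])
       (use that test_spacetimeD(3)[OF \<phi>] in auto)
  have R: "z + s *\<^sub>R ?e \<in> ?R \<longleftrightarrow> z \<in> ?R" "z + ?e \<in> ?R \<longleftrightarrow> z \<in> ?R" for z s
    by (simp_all only: constant_alongD[OF cross_section_constant(2)])
  note cc = constant_alongD[OF c_const]
  have f_per: "periodic_along \<Omega> ?e f"
    unfolding periodic_along_def
  proof (intro impI allI)
    fix z :: "(real^3) \<times> real" assume \<Omega>: "\<Omega> = Torus"
    have "w (z + ?e) = w z" using w_per \<Omega> unfolding periodic_along_def by blast
    moreover have "c (fst (z + ?e)) = c (fst z)" by (simp add: cc)
    ultimately show "f (z + ?e) = f z"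
      using trans[OF \<Omega>, of z] by (auto simp: f_def R pdt_def pdx_def indicator_def)
  qed
  have ind: "indicator ?Q z *\<^sub>R (w z * (pdt \<phi> z \<bullet> k) + w z * c (fst z) * (pdx i \<phi> z \<bullet> k))
      = indicator (slab \<Omega> ?e) z *\<^sub>R f z" for z
    unfolding cell_times_eq[of \<Omega> i] by (simp add: f_def indicator_def)
  show Q_int: "set_integrable lborel ?Q (\<lambda>z. w z * (pdt \<phi> z \<bullet> k) + w z * c (fst z) * (pdx i \<phi> z \<bullet> k))"
    unfolding pdt_def pdx_def
    by (intro set_integral_add set_integrable_times_test_derivative[OF axis_accessible_spacetime
          test_spacetimeD(1)[OF \<phi>] cell_times_borel _ test_spacetimeD(2)[OF \<phi>]] w wc) auto
  have f_int: "set_integrable lborel (slab \<Omega> ?e) f"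
    using Q_int by (simp only: set_integrable_def ind)
  define g where "g z = f (z + (snd z * c (fst z)) *\<^sub>R ?e)" for z
  have shear: "constant_along ?e (\<lambda>z. snd z * c (fst z))"
    by (simp add: constant_along_def cc)
  have g: "set_integrable lborel (slab \<Omega> ?e) g"
    "(LINT z:slab \<Omega> ?e|lborel. g z) = (LINT z:slab \<Omega> ?e|lborel. f z)"
    unfolding g_def
    by (rule set_integrable_shear set_integral_shear, simp, measurable,
        rule axis_Basis, rule shear, rule f_per, rule f_int)+
  have g_eq: "indicator (slab \<Omega> ?e) (x, t) *\<^sub>R g (x, t) = indicator (cell \<Omega>) x * w\<^sub>0 x
      * (indicator {0..} t *\<^sub>R ((pdt \<phi> (x + (t * c x) *\<^sub>R axis i 1, t)
            + c x *\<^sub>R pdx i \<phi> (x + (t * c x) *\<^sub>R axis i 1, t)) \<bullet> k))" for x t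
  proof -
    have "indicator (slab \<Omega> ?e) (x, t) * (indicator ?R (x, t) :: real)
        = indicator ?Q (x, t)"
      unfolding cell_times_eq[of \<Omega> i] by (simp add: indicator_inter_arith)
    also have "\<dots> = indicator (cell \<Omega>) x * indicator {0..} t"
      by (simp add: indicator_times)
    finally have i: "indicator (slab \<Omega> ?e) (x, t) * (indicator ?R (x, t) :: real)
        = indicator (cell \<Omega>) x * indicator {0..} t" .
    have "g (x, t) = indicator ?R (x, t) * (w\<^sub>0 x * ((pdt \<phi> (x + (t * c x) *\<^sub>R axis i 1, t)
            + c x *\<^sub>R pdx i \<phi> (x + (t * c x) *\<^sub>R axis i 1, t)) \<bullet> k))"
      using R(1)[of "(x, t)" "t * c x"]
      by (simp add: g_def f_def cc flow indicator_def inner_add_left algebra_simps del: mem_Sigma_iff)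
    then show ?thesis using i by (simp add: mult.assoc[symmetric])
  qed
  have inner: "(\<integral>t. indicator (slab \<Omega> ?e) (x, t) *\<^sub>R g (x, t) \<partial>lborel)
      = - (indicator (cell \<Omega>) x *\<^sub>R (w\<^sub>0 x * (\<phi> (x, 0) \<bullet> k)))" for x
    unfolding g_eq
    using integral_along_flow_line[OF \<phi>, unfolded set_lebesgue_integral_def]
    by (simp add: mult.assoc)
  have g_int: "integrable (lborel \<Otimes>\<^sub>M lborel) (\<lambda>z. indicator (slab \<Omega> ?e) z *\<^sub>R g z)"
    using g(1) by (simp add: set_integrable_def lborel_prod)
  \<comment> \<open>Up to sign, the initial integrand is the t-integral of the sheared integrand, so
    Fubini yields its integrability as well.\<close>
  show "set_integrable lborel (cell \<Omega>) (\<lambda>x. w\<^sub>0 x * (\<phi> (x, 0) \<bullet> k))"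
    using lborel_pair.integrable_fst'[OF g_int] unfolding inner
    by (simp add: set_integrable_def)
  have "(LINT z:?Q|lborel. w z * (pdt \<phi> z \<bullet> k) + w z * c (fst z) * (pdx i \<phi> z \<bullet> k))
      = (LINT z:slab \<Omega> ?e|lborel. f z)"
    by (simp only: set_lebesgue_integral_def ind)
  also have "\<dots> = (\<integral>z. indicator (slab \<Omega> ?e) z *\<^sub>R g z \<partial>(lborel \<Otimes>\<^sub>M lborel))"
    using g(2) by (simp add: set_lebesgue_integral_def lborel_prod)
  also have "\<dots> = (\<integral>x. \<integral>t. indicator (slab \<Omega> ?e) (x, t) *\<^sub>R g (x, t) \<partial>lborel \<partial>lborel)"
    by (rule lborel_pair.integral_fst'[OF g_int, symmetric])
  also have "\<dots> = - (LINT x:cell \<Omega>|lborel. w\<^sub>0 x * (\<phi> (x, 0) \<bullet> k))"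
    unfolding inner by (simp add: set_lebesgue_integral_def)
  finally show "(LINT z:?Q|lborel. w z * (pdt \<phi> z \<bullet> k) + w z * c (fst z) * (pdx i \<phi> z \<bullet> k))
      = - (LINT x:cell \<Omega>|lborel. w\<^sub>0 x * (\<phi> (x, 0) \<bullet> k))" .
qed

section \<open>Local square integrability and Borel representatives\<close>

lemma shear_flow_nth:
  "shear_flow u\<^sub>1 u\<^sub>3 z $ 1 = u\<^sub>1 (fst z $ 2)"
  "shear_flow u\<^sub>1 u\<^sub>3 z $ 2 = 0"
  "shear_flow u\<^sub>1 u\<^sub>3 z $ 3 = u\<^sub>3 (fst z $ 1 - snd z * u\<^sub>1 (fst z $ 2))"
  by (auto simp: shear_flow_def split_beta)

lemma shear_data_nth:
  "shear_data u\<^sub>1 u\<^sub>3 x $ 1 = u\<^sub>1 (x $ 2)"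
  "shear_data u\<^sub>1 u\<^sub>3 x $ 2 = 0"
  "shear_data u\<^sub>1 u\<^sub>3 x $ 3 = u\<^sub>3 (x $ 1)"
  by (auto simp: shear_data_def)

lemma borel_measurable_vec3:
  fixes v :: "'a::euclidean_space \<Rightarrow> real^3"
  assumes "\<And>i. (\<lambda>z. v z $ i) \<in> borel_measurable borel"
  shows "v \<in> borel_measurable borel"
  by (subst borel_measurable_euclidean_space)
     (use assms in \<open>auto simp: Basis_vec_def inner_axis\<close>)

lemma shear_flow_borel:
  assumes [measurable]: "f\<^sub>1 \<in> borel_measurable borel" "f\<^sub>3 \<in> borel_measurable borel"
  shows "shear_flow f\<^sub>1 f\<^sub>3 \<in> borel_measurable borel"
proof (rule borel_measurable_vec3)
  fix i
  show "(\<lambda>z. shear_flow f\<^sub>1 f\<^sub>3 z $ i) \<in> borel_measurable borel"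
    by (rule exhaust_3[THEN disjE, of i]; (elim disjE)?) (simp_all add: shear_flow_nth)
qed

lemma shear_data_borel:
  assumes [measurable]: "f\<^sub>1 \<in> borel_measurable borel" "f\<^sub>3 \<in> borel_measurable borel"
  shows "shear_data f\<^sub>1 f\<^sub>3 \<in> borel_measurable borel"
proof (rule borel_measurable_vec3)
  fix i
  show "(\<lambda>z. shear_data f\<^sub>1 f\<^sub>3 z $ i) \<in> borel_measurable borel"
    by (rule exhaust_3[THEN disjE, of i]; (elim disjE)?) (simp_all add: shear_data_nth)
qed

text \<open>This allows the weak formulation to be split into separately integrable terms. Compact
  sets have finite measure, so linear terms are covered by |y| <= 1 + y^2.\<close>

lemma
  fixes v :: "'a::euclidean_space \<Rightarrow> real^3"
  assumes v[measurable]: "v \<in> borel_measurable borel" and L: "loc_integrable S (\<lambda>z. (norm (v z))\<^sup>2)"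
  shows loc_integrable_component: "loc_integrable S (\<lambda>z. v z $ i)"
    and loc_integrable_component_product: "loc_integrable S (\<lambda>z. v z $ i * v z $ j)"
proof -
  have [measurable]: "(\<lambda>z. v z $ i) \<in> borel_measurable borel" for i by measurable
  have b: "\<bar>v z $ i\<bar> \<le> norm (v z)" for z i by (rule component_le_norm_cart)
  have b2: "\<bar>v z $ i * v z $ j\<bar> \<le> 1 + (norm (v z))\<^sup>2" for z i j
    using mult_mono[OF b[of z i] b[of z j]] by (simp add: abs_mult power2_eq_square)
  have b1: "\<bar>v z $ i\<bar> \<le> 1 + (norm (v z))\<^sup>2" for z i
  proof -
    have "0 \<le> (norm (v z) - 1)\<^sup>2" by simp
    then show ?thesis using b[of z i] by (auto simp: power2_eq_square algebra_simps)
  qed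
  have *: "set_integrable lborel K g"
    if K: "compact K" "K \<subseteq> S" and [measurable]: "g \<in> borel_measurable borel"
      and g: "\<And>z. \<bar>g z\<bar> \<le> 1 + (norm (v z))\<^sup>2" for K and g :: "'a \<Rightarrow> real"
  proof -
    have [measurable]: "K \<in> sets borel" using K borel_compact by blast
    have "set_integrable lborel K (\<lambda>z. 1 + (norm (v z))\<^sup>2)"
      using K L emeasure_compact_finite[of K]
      by (intro set_integral_add) (auto simp: loc_integrable_def set_integrable_def top.not_eq_extremum)
    then show ?thesis
      by (rule set_integrable_bound) (use g in \<open>auto simp: set_borel_measurable_def\<close>)
  qed
  show "loc_integrable S (\<lambda>z. v z $ i)"
    using * b1 by (auto simp: loc_integrable_def)
  show "loc_integrable S (\<lambda>z. v z $ i * v z $ j)"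
    using * b2 by (auto simp: loc_integrable_def)
qed

text \<open>Measurability of \<open>f\<close> on \<open>Q\<close> is a consequence: Lebesgue measure
  is complete, so agreement with \<open>g\<close> outside a null set suffices. Computations can thus
  be done with Borel functions over \<open>lborel\<close>.\<close>

lemma set_integral_lebesgue_AE:
  fixes f g :: "'a::euclidean_space \<Rightarrow> 'b::euclidean_space"
  assumes g: "set_integrable lborel Q g" and fg: "AE z in lborel. f z = g z"
  shows "set_integrable lebesgue Q f" "(LINT z:Q|lebesgue. f z) = (LINT z:Q|lborel. g z)"
proof -
  have m: "(\<lambda>z. indicator Q z *\<^sub>R g z) \<in> borel_measurable lborel"
    using g by (auto simp: set_integrable_def)
  then have gm: "(\<lambda>z. indicator Q z *\<^sub>R g z) \<in> borel_measurable lebesgue"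
    by (rule measurable_completion)
  have gi: "integrable lebesgue (\<lambda>z. indicator Q z *\<^sub>R g z)"
    using g m by (simp add: set_integrable_def integrable_completion)
  have ae: "AE z in lebesgue. indicator Q z *\<^sub>R g z = indicator Q z *\<^sub>R f z"
    using fg by (auto simp: AE_completion_iff)
  have fm: "(\<lambda>z. indicator Q z *\<^sub>R f z) \<in> borel_measurable lebesgue"
    by (rule borel_measurable_AE[OF gm ae])
  show "set_integrable lebesgue Q f"
    unfolding set_integrable_def by (rule integrable_cong_AE_imp[OF gi fm ae])
  have "(LINT z:Q|lebesgue. f z) = (LINT z:Q|lebesgue. g z)"
    unfolding set_lebesgue_integral_def
    by (rule integral_cong_AE[OF fm gm]) (use ae in \<open>auto elim: eventually_mono\<close>)
  also have "\<dots> = (LINT z:Q|lborel. g z)"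
    unfolding set_lebesgue_integral_def by (rule integral_completion[OF m])
  finally show "(LINT z:Q|lebesgue. f z) = (LINT z:Q|lborel. g z)" .
qed

lemma L2_locI:
  fixes u v :: "'a::euclidean_space \<Rightarrow> 'b::euclidean_space"
  assumes [measurable]: "v \<in> borel_measurable borel" "S \<in> sets borel"
    and uv: "AE z in lborel. u z = v z" and v: "loc_integrable S (\<lambda>z. (norm (v z))\<^sup>2)"
  shows "L2_loc S u"
  unfolding L2_loc_def
proof (intro conjI allI impI)
  have "(\<lambda>z. indicator S z *\<^sub>R v z) \<in> borel_measurable lborel" by measurable
  then have "(\<lambda>z. indicator S z *\<^sub>R v z) \<in> borel_measurable lebesgue"
    by (rule measurable_completion)
  moreover have "AE z in lebesgue. indicator S z *\<^sub>R v z = indicator S z *\<^sub>R u z"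
    using uv by (auto simp: AE_completion_iff)
  ultimately show "set_borel_measurable lebesgue S u"
    unfolding set_borel_measurable_def by (rule borel_measurable_AE)
  fix K assume "compact K \<and> K \<subseteq> S"
  then have "set_integrable lborel K (\<lambda>z. (norm (v z))\<^sup>2)" using v by (simp add: loc_integrable_def)
  then show "set_integrable lebesgue K (\<lambda>z. (norm (u z))\<^sup>2)"
    by (rule set_integral_lebesgue_AE) (use uv in auto)
qed

lemma set_integrable_lborel_AE:
  fixes f g :: "'a::euclidean_space \<Rightarrow> 'b::euclidean_space"
  assumes f: "set_integrable lebesgue K f" and [measurable]: "g \<in> borel_measurable borel" "K \<in> sets borel"
    and fg: "AE z in lborel. f z = g z"
  shows "set_integrable lborel K g"
proof -
  have m: "(\<lambda>z. indicator K z *\<^sub>R g z) \<in> borel_measurable lborel" by measurable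
  have "integrable lebesgue (\<lambda>z. indicator K z *\<^sub>R g z)"
    using f unfolding set_integrable_def
    by (rule integrable_cong_AE_imp[OF _ measurable_completion[OF m]])
       (use fg in \<open>auto simp: AE_completion_iff\<close>)
  then show ?thesis using m by (simp add: set_integrable_def integrable_completion)
qed

lemma L2_locD:
  fixes u v :: "'a::euclidean_space \<Rightarrow> 'b::euclidean_space"
  assumes u: "L2_loc S u" and [measurable]: "v \<in> borel_measurable borel"
    and uv: "AE z in lborel. u z = v z"
  shows "loc_integrable S (\<lambda>z. (norm (v z))\<^sup>2)"
  unfolding loc_integrable_def
proof (intro conjI allI impI)
  fix K assume K: "compact K \<and> K \<subseteq> S"
  then have "set_integrable lebesgue K (\<lambda>z. (norm (u z))\<^sup>2)" using u by (simp add: L2_loc_def)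
  then show "set_integrable lborel K (\<lambda>z. (norm (v z))\<^sup>2)"
    by (rule set_integrable_lborel_AE) (use uv K borel_compact in auto)
qed measurable

lemma set_integrable_profile:
  fixes c :: "'a::euclidean_space \<Rightarrow> real" and p :: "real \<Rightarrow> real"
  assumes [measurable]: "c \<in> borel_measurable borel" "p \<in> borel_measurable borel"
    and e: "e \<in> Basis" and c: "constant_along e c" and K: "compact K" and M: "M < top"
    and p: "\<And>a. (\<integral>\<^sup>+s. indicator {0..1} s * ennreal (norm (p (a + s))) \<partial>lborel) \<le> M"
  shows "set_integrable lborel K (\<lambda>z. p (z \<bullet> e + c z))"
proof -
  have [measurable]: "K \<in> sets borel" using K borel_compact by blast
  have "(\<integral>\<^sup>+z. indicator K z * ennreal (norm (p (z \<bullet> e + c z))) \<partial>lborel) < top"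
    by (rule nn_integral_profile_finite[where p = "\<lambda>y. ennreal (norm (p y))", OF _ _ _ e c _ M p])
       (use K compact_imp_bounded in auto)
  moreover have "ennreal (norm (indicator K z *\<^sub>R p (z \<bullet> e + c z)))
      = indicator K z * ennreal (norm (p (z \<bullet> e + c z)))" for z
    by (simp add: indicator_def)
  ultimately show ?thesis
    unfolding set_integrable_def integrable_iff_bounded by simp
qed

text \<open>\<open>K\<close> sees the values of \<open>p\<close> on a bounded interval only. Once
  \<open>p\<close> is cut off there, its total mass bounds the mass of every unit window.\<close>

lemma loc_integrable_profile:
  assumes p: "loc_integrable UNIV p" and e: "e \<in> Basis"
  shows "loc_integrable UNIV (\<lambda>z. p (z \<bullet> e))"
  unfolding loc_integrable_def
proof (intro conjI allI impI)
  have [measurable]: "p \<in> borel_measurable borel" using p by (simp add: loc_integrable_def)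
  then show "(\<lambda>z. p (z \<bullet> e)) \<in> borel_measurable borel" by measurable
  fix K :: "'a set" assume K: "compact K \<and> K \<subseteq> UNIV"
  then obtain r where r: "\<And>z. z \<in> K \<Longrightarrow> norm z \<le> r"
    using compact_imp_bounded[of K] unfolding bounded_iff by blast
  define q where "q y = indicator {-r..r} y * p y" for y
  have [measurable]: "q \<in> borel_measurable borel" unfolding q_def by measurable
  have "set_integrable lborel {-r..r} p" using p by (simp add: loc_integrable_def)
  then have q: "(\<integral>\<^sup>+s. ennreal (norm (q s)) \<partial>lborel) < top"
    by (simp add: set_integrable_def integrable_iff_bounded q_def)
  have "set_integrable lborel K (\<lambda>z. q (z \<bullet> e + 0))"
  proof (rule set_integrable_profile[OF _ _ e _ _ q])
    fix a
    have "(\<integral>\<^sup>+s. indicator {0..1} s * ennreal (norm (q (a + s))) \<partial>lborel)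
        \<le> (\<integral>\<^sup>+s. ennreal (norm (q (s + a))) \<partial>lborel)"
      by (intro nn_integral_mono) (auto simp: indicator_def add.commute)
    also have "\<dots> = (\<integral>\<^sup>+s. ennreal (norm (q s)) \<partial>lborel)"
      by (rule nn_integral_lborel_translate) measurable
    finally show "(\<integral>\<^sup>+s. indicator {0..1} s * ennreal (norm (q (a + s))) \<partial>lborel)
        \<le> (\<integral>\<^sup>+s. ennreal (norm (q s)) \<partial>lborel)" .
  qed (use K in \<open>auto simp: constant_along_def\<close>)
  moreover have "q (z \<bullet> e + 0) = p (z \<bullet> e)" if "z \<in> K" for z
  proof -
    have "\<bar>z \<bullet> e\<bar> \<le> r" using Basis_le_norm[OF e, of z] r[OF that] by simp
    then show ?thesis by (auto simp: q_def indicator_def abs_le_iff)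
  qed
  ultimately show "set_integrable lborel K (\<lambda>z. p (z \<bullet> e))"
    by (simp cong: set_integrable_cong)
qed

text \<open>By periodicity all unit windows carry the same mass, a uniform bound whatever the shift
  \<open>c\<close>. On the whole space, in contrast, an unbounded shift can bring in large values
  from far away.\<close>

lemma loc_integrable_periodic_profile:
  fixes p :: "real \<Rightarrow> real"
  assumes [measurable]: "c \<in> borel_measurable borel" "p \<in> borel_measurable borel"
    and e: "e \<in> Basis" and c: "constant_along e c"
    and per: "\<And>y. p (y + 1) = p y" and p: "set_integrable lborel {0..1} p"
  shows "loc_integrable UNIV (\<lambda>z. p (z \<bullet> e + c z))"
  unfolding loc_integrable_def
proof (intro conjI allI impI)
  fix K :: "'a set" assume K: "compact K \<and> K \<subseteq> UNIV"
  have "(\<integral>\<^sup>+s. ennreal (norm (indicator {0..1} s *\<^sub>R p s)) \<partial>lborel) < top"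
    using p by (simp add: set_integrable_def integrable_iff_bounded)
  also have "(\<lambda>s. ennreal (norm (indicator {0..1} s *\<^sub>R p s)))
      = (\<lambda>s. indicator {0..1} s * ennreal (norm (p s)))"
    by (auto simp: indicator_def)
  finally have "(\<integral>\<^sup>+s. indicator {0..1} s * ennreal (norm (p s)) \<partial>lborel) < top" .
  then show "set_integrable lborel K (\<lambda>z. p (z \<bullet> e + c z))"
    by (rule set_integrable_profile[rotated 5])
       (use K e c per nn_integral_unit_period[of "\<lambda>y. ennreal (norm (p y))"] in auto)
qed measurable

lemma loc_integrable_subset: "loc_integrable UNIV w \<Longrightarrow> loc_integrable S w"
  by (auto simp: loc_integrable_def)

lemma loc_integrable_add:
  "loc_integrable S v \<Longrightarrow> loc_integrable S w \<Longrightarrow> loc_integrable S (\<lambda>z. v z + w z)"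
  by (auto simp: loc_integrable_def intro: set_integral_add)

section \<open>Weak solutions\<close>

lemma test_spaceD:
  assumes "test_space \<Omega> \<psi>"
  shows "smooth_on UNIV \<psi>"
    and "compact (closure {x \<in> UNIV. \<psi> x \<noteq> 0} \<inter> cell \<Omega>)"
    and "\<And>x. \<Omega> = Torus \<Longrightarrow> x \<in> UNIV \<Longrightarrow> \<psi> (x + axis i 1) = \<psi> x"
  using assms by (auto simp: test_space_def)

lemma
  fixes \<psi> :: "real^3 \<Rightarrow> real"
  assumes \<psi>: "test_space \<Omega> \<psi>" and w: "loc_integrable UNIV w" "constant_along (axis i 1) w"
  shows set_integrable_space_derivative:
      "set_integrable lborel (cell \<Omega>) (\<lambda>x. w x * frechet_derivative \<psi> (at x) (axis i 1))"
    and set_integral_space_derivative_eq_0: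
      "(LINT x:cell \<Omega>|lborel. w x * frechet_derivative \<psi> (at x) (axis i 1)) = 0"
proof -
  show "set_integrable lborel (cell \<Omega>) (\<lambda>x. w x * frechet_derivative \<psi> (at x) (axis i 1))"
    using set_integrable_times_test_derivative[OF axis_accessible_UNIV
        test_spaceD(1)[OF \<psi>] cell_borel _ test_spaceD(2)[OF \<psi>] w(1), where k = 1]
    by simp
  show "(LINT x:cell \<Omega>|lborel. w x * frechet_derivative \<psi> (at x) (axis i 1)) = 0"
    using set_integral_test_derivative_eq_0[OF axis_accessible_UNIV
        test_spaceD(1)[OF \<psi>] cell_eq cross_section_borel _ cross_section_constant(1)
        axis_Basis(1) test_spaceD(2)[OF \<psi>] test_spaceD(3)[OF \<psi>] w, where k = 1]
    by simp
qed

lemma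
  fixes \<phi> :: "(real^3) \<times> real \<Rightarrow> 'b::euclidean_space"
  assumes \<phi>: "test_spacetime \<Omega> \<phi>"
    and w: "loc_integrable spacetime w" "constant_along (axis i 1, 0) w"
  shows set_integrable_pdx: "set_integrable lborel (cell \<Omega> \<times> {0..}) (\<lambda>z. w z * (pdx i \<phi> z \<bullet> k))"
    and set_integral_pdx_eq_0: "(LINT z:cell \<Omega> \<times> {0..}|lborel. w z * (pdx i \<phi> z \<bullet> k)) = 0"
proof -
  show "set_integrable lborel (cell \<Omega> \<times> {0..}) (\<lambda>z. w z * (pdx i \<phi> z \<bullet> k))"
    unfolding pdx_def
    by (rule set_integrable_times_test_derivative[OF axis_accessible_spacetime
        test_spacetimeD(1)[OF \<phi>] cell_times_borel _ test_spacetimeD(2)[OF \<phi>] w(1)]) auto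
  show "(LINT z:cell \<Omega> \<times> {0..}|lborel. w z * (pdx i \<phi> z \<bullet> k)) = 0"
    unfolding pdx_def
    by (rule set_integral_test_derivative_eq_0[OF axis_accessible_spacetime
        test_spacetimeD(1)[OF \<phi>] cell_times_eq cross_section_times_borel _
        cross_section_constant(2) axis_Basis(2) test_spacetimeD(2)[OF \<phi>]
        test_spacetimeD(3)[OF \<phi>] w]) auto
qed

text \<open>Together with the vanishing second component, this makes each term of the weak
  divergence integrate to zero by itself.\<close>

lemma shear_flow_constant:
  "constant_along (axis 3 1, 0) (\<lambda>z. shear_flow f\<^sub>1 f\<^sub>3 z $ i)"
  "constant_along (axis 1 1, 0) (\<lambda>z. shear_flow f\<^sub>1 f\<^sub>3 z $ 1)"
  by (auto simp: constant_along_def shear_flow_def axis_def split_beta)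

lemma shear_data_constant:
  "constant_along (axis 3 1) (\<lambda>x. shear_data f\<^sub>1 f\<^sub>3 x $ i)"
  "constant_along (axis 1 1) (\<lambda>x. shear_data f\<^sub>1 f\<^sub>3 x $ 1)"
  by (auto simp: constant_along_def shear_data_def axis_def)

lemma shear_flow_along_flow:
  "shear_flow f\<^sub>1 f\<^sub>3 (x + (t * f\<^sub>1 (x $ 2)) *\<^sub>R axis 1 1, t) = shear_data f\<^sub>1 f\<^sub>3 x"
  by (simp add: vec_eq_iff forall_3 shear_flow_nth shear_data_nth axis_def)

lemma shear_flow_periodic:
  assumes "\<And>y. u\<^sub>1 (y + 1) = u\<^sub>1 y" "\<And>y. u\<^sub>3 (y + 1) = u\<^sub>3 y"
  shows "shear_flow u\<^sub>1 u\<^sub>3 (x + axis i 1, t) = shear_flow u\<^sub>1 u\<^sub>3 (x, t)"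
proof -
  have "u\<^sub>3 (b + 1 - a) = u\<^sub>3 (b - a)" for a b
    using assms(2)[of "b - a"] by (simp add: algebra_simps)
  then show ?thesis
    using exhaust_3[of i] assms(1) by (auto simp: vec_eq_iff forall_3 shear_flow_nth axis_def)
qed

text \<open>Both domains are reduced to local square integrability of the Borel flow and its data.
  Almost everywhere equality suffices for the integrals, while periodicity is a pointwise condition
  and is asked of \<open>u\<close> and \<open>u\<^sub>0\<close> themselves.\<close>

lemma weak_Euler_solution_shear_flow:
  assumes [measurable]: "f\<^sub>1 \<in> borel_measurable borel" "f\<^sub>3 \<in> borel_measurable borel"
    and per: "\<Omega> = Torus \<Longrightarrow> (\<forall>y. f\<^sub>1 (y + 1) = f\<^sub>1 y) \<and> (\<forall>y. f\<^sub>3 (y + 1) = f\<^sub>3 y)"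
    and L: "loc_integrable spacetime (\<lambda>z. (norm (shear_flow f\<^sub>1 f\<^sub>3 z))\<^sup>2)"
    and L0: "loc_integrable UNIV (\<lambda>x. (norm (shear_data f\<^sub>1 f\<^sub>3 x))\<^sup>2)"
    and u: "AE z in lborel. u z = shear_flow f\<^sub>1 f\<^sub>3 z" "\<forall>t\<ge>0. descends \<Omega> (\<lambda>x. u (x, t))"
    and u0: "AE x in lborel. u\<^sub>0 x = shear_data f\<^sub>1 f\<^sub>3 x" "descends \<Omega> u\<^sub>0"
  shows "weak_Euler_solution \<Omega> u\<^sub>0 u"
proof -
  define v where "v = shear_flow f\<^sub>1 f\<^sub>3"
  define v\<^sub>0 where "v\<^sub>0 = shear_data f\<^sub>1 f\<^sub>3"
  have v[measurable]: "v \<in> borel_measurable borel" and v0[measurable]: "v\<^sub>0 \<in> borel_measurable borel"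
    unfolding v_def v\<^sub>0_def by (intro shear_flow_borel shear_data_borel; simp)+
  note uv = u(1)[folded v_def] and uv0 = u0(1)[folded v\<^sub>0_def]
  note vL = loc_integrable_component[OF v L[folded v_def]]
    and vL2 = loc_integrable_component_product[OF v L[folded v_def]]
    and vL0 = loc_integrable_component[OF v0 L0[folded v\<^sub>0_def]]
  note vc = shear_flow_constant[of f\<^sub>1 f\<^sub>3, folded v_def]
    and vc0 = shear_data_constant[of f\<^sub>1 f\<^sub>3, folded v\<^sub>0_def]
  have v2: "v z $ 2 = 0" "v\<^sub>0 x $ 2 = 0" for z x
    by (simp_all add: v_def v\<^sub>0_def shear_flow_nth shear_data_nth)
  have "weakly_div_free_space \<Omega> u\<^sub>0"
    unfolding weakly_div_free_space_def
  proof (intro allI impI)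
    fix \<psi> :: "real^3 \<Rightarrow> real" assume \<psi>: "test_space \<Omega> \<psi>"
    let ?g = "\<lambda>i x. v\<^sub>0 x $ i * frechet_derivative \<psi> (at x) (axis i 1)"
    have int: "set_integrable lborel (cell \<Omega>) (?g 1)" "set_integrable lborel (cell \<Omega>) (?g 3)"
      by (intro set_integrable_space_derivative \<psi> vL0 vc0)+
    have "(LINT x:cell \<Omega>|lebesgue. \<Sum>i\<in>UNIV. u\<^sub>0 x $ i * frechet_derivative \<psi> (at x) (axis i 1))
        = (LINT x:cell \<Omega>|lborel. ?g 1 x + ?g 3 x)"
      by (rule set_integral_lebesgue_AE(2)[OF set_integral_add(1)[OF int]])
         (use uv0 in eventually_elim, simp add: sum_3 v2)
    also have "\<dots> = 0"
      using set_integral_space_derivative_eq_0[OF \<psi> vL0 vc0(1)]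
        set_integral_space_derivative_eq_0[OF \<psi> vL0 vc0(2)]
      by (simp add: set_integral_add(2)[OF int])
    finally show "(LINT x:cell \<Omega>|lebesgue. \<Sum>i\<in>UNIV. u\<^sub>0 x $ i
        * frechet_derivative \<psi> (at x) (axis i 1)) = 0" .
  qed
  moreover have "weakly_div_free_spacetime \<Omega> u"
    unfolding weakly_div_free_spacetime_def
  proof (intro allI impI)
    fix \<psi> :: "(real^3) \<times> real \<Rightarrow> real" assume \<psi>: "test_spacetime \<Omega> \<psi>"
    let ?g = "\<lambda>i z. v z $ i * (pdx i \<psi> z \<bullet> 1)"
    have int: "set_integrable lborel (cell \<Omega> \<times> {0..}) (?g 1)"
        "set_integrable lborel (cell \<Omega> \<times> {0..}) (?g 3)"
      by (intro set_integrable_pdx \<psi> vL vc)+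
    have "(LINT z:cell \<Omega> \<times> {0..}|lebesgue. \<Sum>i\<in>UNIV. u z $ i * pdx i \<psi> z)
        = (LINT z:cell \<Omega> \<times> {0..}|lborel. ?g 1 z + ?g 3 z)"
      by (rule set_integral_lebesgue_AE(2)[OF set_integral_add(1)[OF int]])
         (use uv in eventually_elim, simp add: sum_3 v2)
    also have "\<dots> = 0"
      by (simp only: set_integral_add(2)[OF int] set_integral_pdx_eq_0[OF \<psi> vL vc(1)]
        set_integral_pdx_eq_0[OF \<psi> vL vc(2)] add_0)
    finally show "(LINT z:cell \<Omega> \<times> {0..}|lebesgue. \<Sum>i\<in>UNIV. u z $ i * pdx i \<psi> z) = 0" .
  qed
  moreover have "(LINT z:cell \<Omega> \<times> {0..}|lebesgue.
            u z \<bullet> pdt \<phi> z + (\<Sum>i\<in>UNIV. \<Sum>j\<in>UNIV. u z $ i * u z $ j * pdx j \<phi> z $ i))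
        = - (LINT x:cell \<Omega>|lebesgue. u\<^sub>0 x \<bullet> \<phi> (x, 0))"
    if \<phi>: "test_spacetime \<Omega> \<phi>" for \<phi> :: "(real^3) \<times> real \<Rightarrow> real^3"
  proof -
    define c where "c x = f\<^sub>1 (x $ 2)" for x :: "real^3"
    have [measurable]: "c \<in> borel_measurable borel" unfolding c_def by measurable
    have c: "constant_along (axis 1 1) c" by (simp add: constant_along_def c_def axis_def)
    have vc1: "v z $ 1 = c (fst z)" for z by (simp add: v_def shear_flow_nth c_def)
    have v_per: "periodic_along \<Omega> (axis 1 1, 0) (\<lambda>z. v z $ i)" for i
      unfolding periodic_along_def
    proof (intro impI allI)
      fix z :: "(real^3) \<times> real" assume \<Omega>: "\<Omega> = Torus"
      have "v (z + (axis 1 1, 0)) = v z"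
        using shear_flow_periodic[of f\<^sub>1 f\<^sub>3 "fst z" 1 "snd z"] per[OF \<Omega>]
        by (cases z) (simp add: v_def)
      then show "v (z + (axis 1 1, 0)) $ i = v z $ i" by simp
    qed
    have flow: "v (x + (t * c x) *\<^sub>R axis 1 1, t) $ i = v\<^sub>0 x $ i" for x t i
      by (simp add: v_def v\<^sub>0_def c_def shear_flow_along_flow)
    have vcL: "loc_integrable spacetime (\<lambda>z. v z $ i * c (fst z))" for i
      using vL2[of i 1] by (simp add: vc1)
    let ?Q = "cell \<Omega> \<times> {0::real..}"
    \<comment> \<open>As the second component vanishes, only the indices 1 and 3 survive.
      \<open>A\<close> collects the derivatives in t and x1, with the first velocity component
      written as \<open>c\<close> to match the transport identity; \<open>B\<close> collects the x3
      derivatives, whose coefficients are constant along x3.\<close>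
    define A where "A i z = v z $ i * (pdt \<phi> z \<bullet> axis i 1)
        + v z $ i * c (fst z) * (pdx 1 \<phi> z \<bullet> axis i 1)" for i z
    define B where "B i z = v z $ i * v z $ 3 * (pdx 3 \<phi> z \<bullet> axis i 1)" for i z
    define C where "C i x = v\<^sub>0 x $ i * (\<phi> (x, 0) \<bullet> axis i 1)" for i x
    have A: "set_integrable lborel ?Q (A i)" "set_integrable lborel (cell \<Omega>) (C i)"
        "(LINT z:?Q|lborel. A i z) = - (LINT x:cell \<Omega>|lborel. C i x)" for i
      unfolding A_def C_def
      by (rule set_integrable_transport[OF \<phi> _ c vL vcL v_per flow]
          set_integrable_initial[OF \<phi> _ c vL vcL v_per flow]
          set_integral_transport[OF \<phi> _ c vL vcL v_per flow], measurable)+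
    have v33: "constant_along (axis 3 1, 0) (\<lambda>z. v z $ i * v z $ 3)" for i
      using vc(1)[of i] vc(1)[of 3] by (simp add: constant_along_def)
    have B: "set_integrable lborel ?Q (B i)" "(LINT z:?Q|lborel. B i z) = 0" for i
      unfolding B_def by (rule set_integrable_pdx[OF \<phi> vL2 v33] set_integral_pdx_eq_0[OF \<phi> vL2 v33])+
    have int: "set_integrable lborel ?Q (\<lambda>z. A 1 z + A 3 z)" "set_integrable lborel ?Q (\<lambda>z. B 1 z + B 3 z)"
      by (intro set_integral_add A B)+
    have "(LINT z:?Q|lebesgue.
            u z \<bullet> pdt \<phi> z + (\<Sum>i\<in>UNIV. \<Sum>j\<in>UNIV. u z $ i * u z $ j * pdx j \<phi> z $ i))
        = (LINT z:?Q|lborel. (A 1 z + A 3 z) + (B 1 z + B 3 z))"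
      by (rule set_integral_lebesgue_AE(2)[OF set_integral_add(1)[OF int]])
         (use uv in eventually_elim,
          simp add: A_def B_def sum_3 v2 inner_vec_def[of "v _"] inner_axis vc1 algebra_simps)
    also have "\<dots> = - ((LINT x:cell \<Omega>|lborel. C 1 x) + (LINT x:cell \<Omega>|lborel. C 3 x))"
      by (simp add: set_integral_add(2) int A B)
    also have "\<dots> = - (LINT x:cell \<Omega>|lborel. C 1 x + C 3 x)"
      by (simp add: set_integral_add(2) A)
    also have "(LINT x:cell \<Omega>|lborel. C 1 x + C 3 x) = (LINT x:cell \<Omega>|lebesgue. u\<^sub>0 x \<bullet> \<phi> (x, 0))"
      by (rule set_integral_lebesgue_AE(2)[OF set_integral_add(1)[OF A(2) A(2)], symmetric])
         (use uv0 in eventually_elim, simp add: C_def sum_3 v2 inner_vec_def[of "v\<^sub>0 _"] inner_axis)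
    finally show ?thesis .
  qed
  moreover have "L2_loc_space \<Omega> u\<^sub>0"
    unfolding L2_loc_space_def
    by (intro conjI u0(2) L2_locI[OF v0 _ uv0 L0[folded v\<^sub>0_def]]) simp
  moreover have "L2_loc_spacetime \<Omega> u"
    unfolding L2_loc_spacetime_def
    by (intro conjI u(2) L2_locI[OF v _ uv L[folded v_def]] borel_closed closed_spacetime)
  ultimately show ?thesis by (auto simp: weak_Euler_solution_def)
qed

section \<open>Borel representatives of the profiles and of the flow\<close>

lemma borel_version:
  fixes f :: "real \<Rightarrow> real"
  assumes "f \<in> borel_measurable lebesgue"
  obtains g where "g \<in> borel_measurable borel" "AE y in lborel. f y = g y"
  using completion_ex_borel_measurable_real[OF assms] by auto

text \<open>A Borel version \<open>h\<close> need not be periodic, but its composition with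
  \<open>frac\<close> is. At almost every point \<open>f\<close> and \<open>h\<close> agree on all
  integer translates, these being countably many, hence also at the fractional part.\<close>

lemma periodic_borel_version:
  fixes f :: "real \<Rightarrow> real"
  assumes f: "f \<in> borel_measurable lebesgue" and per: "\<And>y. f (y + 1) = f y"
  obtains g where "g \<in> borel_measurable borel" "AE y in lborel. f y = g y" "\<And>y. g (y + 1) = g y"
proof -
  obtain h where [measurable]: "h \<in> borel_measurable borel" and h: "AE y in lborel. f y = h y"
    using borel_version[OF f] .
  have "AE y :: real in lborel. f (y \<bullet> 1 + of_int k) = h (y \<bullet> 1 + of_int k)" for k :: int
    by (rule AE_lborel_inner_add[OF _ _ _ h]) (auto simp: constant_along_def Basis_real_def)
  then have "AE y in lborel. \<forall>k::int. f (y + of_int k) = h (y + of_int k)"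
    by (simp add: AE_all_countable)
  then have "AE y in lborel. f y = h (frac y)"
  proof eventually_elim
    fix y assume "\<forall>k::int. f (y + of_int k) = h (y + of_int k)"
    then have "f (y + of_int (- \<lfloor>y\<rfloor>)) = h (y + of_int (- \<lfloor>y\<rfloor>))" ..
    moreover have "f (y + of_int (- \<lfloor>y\<rfloor>)) = f y"
      using periodic_shift_int[of f 1 y "- \<lfloor>y\<rfloor>"] per by simp
    ultimately show "f y = h (frac y)" by (simp add: frac_def)
  qed
  moreover have "(\<lambda>y. h (frac y)) \<in> borel_measurable borel"
    unfolding frac_def by measurable
  moreover have "h (frac (y + 1)) = h (frac y)" for y
    by (simp add: frac_def)
  ultimately show thesis using that by blast
qed

text \<open>The exceptional set of \<open>u\<^sub>3\<close> is pulled back by the shift built from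
  \<open>f\<^sub>1\<close>, which is Borel. Where \<open>u\<^sub>1\<close> and
  \<open>f\<^sub>1\<close> agree, this is the true shift.\<close>

lemma AE_shear_flow:
  assumes [measurable]: "f\<^sub>1 \<in> borel_measurable borel"
    and u: "AE y in lborel. u\<^sub>1 y = f\<^sub>1 y" "AE y in lborel. u\<^sub>3 y = f\<^sub>3 y"
  shows "AE z in lborel. shear_flow u\<^sub>1 u\<^sub>3 z = shear_flow f\<^sub>1 f\<^sub>3 z"
proof -
  have "AE z in lborel. u\<^sub>1 ((z :: (real^3) \<times> real) \<bullet> (axis 2 1, 0) + 0) = f\<^sub>1 (z \<bullet> (axis 2 1, 0) + 0)"
    by (rule AE_lborel_inner_add[OF _ axis_Basis(2) _ u(1)]) (auto simp: constant_along_def)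
  moreover have "AE z in lborel. u\<^sub>3 ((z :: (real^3) \<times> real) \<bullet> (axis 1 1, 0) + - (snd z * f\<^sub>1 (fst z $ 2)))
      = f\<^sub>3 (z \<bullet> (axis 1 1, 0) + - (snd z * f\<^sub>1 (fst z $ 2)))"
    by (rule AE_lborel_inner_add[OF _ axis_Basis(2) _ u(2)]) (auto simp: constant_along_def axis_def)
  ultimately show ?thesis
    by eventually_elim (simp add: vec_eq_iff forall_3 shear_flow_nth inner_prod_def inner_axis)
qed

text \<open>A single time is null in space-time, so the space-time statement says nothing about it;
  the energy at time t and the initial data need this version.\<close>

lemma AE_shear_flow_slice:
  assumes [measurable]: "f\<^sub>1 \<in> borel_measurable borel"
    and u: "AE y in lborel. u\<^sub>1 y = f\<^sub>1 y" "AE y in lborel. u\<^sub>3 y = f\<^sub>3 y"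
  shows "AE x in lborel. shear_flow u\<^sub>1 u\<^sub>3 (x, t) = shear_flow f\<^sub>1 f\<^sub>3 (x, t)"
proof -
  have "AE x in lborel. u\<^sub>1 (x \<bullet> axis 2 1 + 0) = f\<^sub>1 ((x :: real^3) \<bullet> axis 2 1 + 0)"
    by (rule AE_lborel_inner_add[OF _ axis_Basis(1) _ u(1)]) (auto simp: constant_along_def)
  moreover have "AE x in lborel. u\<^sub>3 (x \<bullet> axis 1 1 + - (t * f\<^sub>1 (x $ 2)))
      = f\<^sub>3 ((x :: real^3) \<bullet> axis 1 1 + - (t * f\<^sub>1 (x $ 2)))"
    by (rule AE_lborel_inner_add[OF _ axis_Basis(1) _ u(2)]) (auto simp: constant_along_def axis_def)
  ultimately show ?thesis
    by eventually_elim (simp add: vec_eq_iff forall_3 shear_flow_nth inner_axis)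
qed

lemma shear_data_eq_flow: "shear_data u\<^sub>1 u\<^sub>3 = (\<lambda>x. shear_flow u\<^sub>1 u\<^sub>3 (x, 0))"
  by (simp add: fun_eq_iff vec_eq_iff forall_3 shear_flow_nth shear_data_nth)

lemma power2_norm_vec3: "(norm (v :: real^3))\<^sup>2 = (v $ 1)\<^sup>2 + (v $ 2)\<^sup>2 + (v $ 3)\<^sup>2"
  unfolding power2_norm_eq_inner inner_vec_def by (simp add: sum_3 power2_eq_square)

section \<open>The whole space and the torus\<close>

lemma weak_Euler_solution_space:
  assumes u1: "L2_loc UNIV u\<^sub>1" and u3: "L2_loc UNIV u\<^sub>3"
    and u: "L2_loc_spacetime Space (shear_flow u\<^sub>1 u\<^sub>3)"
  shows "weak_Euler_solution Space (shear_data u\<^sub>1 u\<^sub>3) (shear_flow u\<^sub>1 u\<^sub>3)"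
proof -
  have "u\<^sub>1 \<in> borel_measurable lebesgue" "u\<^sub>3 \<in> borel_measurable lebesgue"
    using u1 u3 by (simp_all add: L2_loc_def set_borel_measurable_def)
  then obtain f\<^sub>1 f\<^sub>3 where [measurable]: "f\<^sub>1 \<in> borel_measurable borel" "f\<^sub>3 \<in> borel_measurable borel"
    and f: "AE y in lborel. u\<^sub>1 y = f\<^sub>1 y" "AE y in lborel. u\<^sub>3 y = f\<^sub>3 y"
    by (metis borel_version)
  have uf: "AE z in lborel. shear_flow u\<^sub>1 u\<^sub>3 z = shear_flow f\<^sub>1 f\<^sub>3 z"
    by (rule AE_shear_flow) (simp_all add: f)
  have "loc_integrable UNIV (\<lambda>y. (norm (f\<^sub>1 y))\<^sup>2)" "loc_integrable UNIV (\<lambda>y. (norm (f\<^sub>3 y))\<^sup>2)"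
    by (rule L2_locD[OF u1] L2_locD[OF u3], simp, simp add: f)+
  \<comment> \<open>At time 0 there is no shift, so the profiles alone make the initial data locally
    square integrable.\<close>
  note this[THEN loc_integrable_profile[OF _ axis_Basis(1)]]
  from loc_integrable_add[OF this(1)[of 2] this(2)[of 1]]
  have L0: "loc_integrable UNIV (\<lambda>x. (norm (shear_data f\<^sub>1 f\<^sub>3 x))\<^sup>2)"
    by (simp add: power2_norm_vec3 shear_data_nth inner_axis)
  show ?thesis
  proof (rule weak_Euler_solution_shear_flow[OF _ _ _ _ L0 uf])
    show "loc_integrable spacetime (\<lambda>z. (norm (shear_flow f\<^sub>1 f\<^sub>3 z))\<^sup>2)"
      using u by (intro L2_locD[OF _ shear_flow_borel uf]) (simp_all add: L2_loc_spacetime_def)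
    show "AE x in lborel. shear_data u\<^sub>1 u\<^sub>3 x = shear_data f\<^sub>1 f\<^sub>3 x"
      unfolding shear_data_eq_flow by (rule AE_shear_flow_slice) (simp_all add: f)
  qed simp_all
qed

lemma shear_flow_torus:
  assumes u1: "L2_circle u\<^sub>1" and u3: "L2_circle u\<^sub>3"
  shows "weak_Euler_solution Torus (shear_data u\<^sub>1 u\<^sub>3) (shear_flow u\<^sub>1 u\<^sub>3)"
    and "set_integrable lebesgue (cell Torus) (\<lambda>x. (norm (shear_flow u\<^sub>1 u\<^sub>3 (x, t)))\<^sup>2)"
    and "(LINT x:cell Torus|lebesgue. (norm (shear_flow u\<^sub>1 u\<^sub>3 (x, t)))\<^sup>2)
       = (LINT x:cell Torus|lebesgue. (norm (shear_data u\<^sub>1 u\<^sub>3 x))\<^sup>2)"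
proof -
  have per: "u\<^sub>1 (y + 1) = u\<^sub>1 y" "u\<^sub>3 (y + 1) = u\<^sub>3 y" for y
    using u1 u3 by (auto simp: L2_circle_def)
  obtain f\<^sub>1 where m1[measurable]: "f\<^sub>1 \<in> borel_measurable borel" and f1: "AE y in lborel. u\<^sub>1 y = f\<^sub>1 y"
    and per1: "\<And>y. f\<^sub>1 (y + 1) = f\<^sub>1 y"
    using periodic_borel_version[of u\<^sub>1] u1 by (auto simp: L2_circle_def)
  obtain f\<^sub>3 where m3[measurable]: "f\<^sub>3 \<in> borel_measurable borel" and f3: "AE y in lborel. u\<^sub>3 y = f\<^sub>3 y"
    and per3: "\<And>y. f\<^sub>3 (y + 1) = f\<^sub>3 y"
    using periodic_borel_version[of u\<^sub>3] u3 by (auto simp: L2_circle_def)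
  have sq: "set_integrable lborel {0..1} (\<lambda>y. (f\<^sub>1 y)\<^sup>2)" "set_integrable lborel {0..1} (\<lambda>y. (f\<^sub>3 y)\<^sup>2)"
  proof -
    show "set_integrable lborel {0..1} (\<lambda>y. (f\<^sub>1 y)\<^sup>2)"
      by (rule set_integrable_lborel_AE[where f = "\<lambda>y. (u\<^sub>1 y)\<^sup>2"])
         (use u1 f1 in \<open>auto simp: L2_circle_def\<close>)
    show "set_integrable lborel {0..1} (\<lambda>y. (f\<^sub>3 y)\<^sup>2)"
      by (rule set_integrable_lborel_AE[where f = "\<lambda>y. (u\<^sub>3 y)\<^sup>2"])
         (use u3 f3 in \<open>auto simp: L2_circle_def\<close>)
  qed
  note uf = AE_shear_flow[OF m1 f1 f3] and ufs = AE_shear_flow_slice[OF m1 f1 f3]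
  have "loc_integrable UNIV (\<lambda>z::(real^3) \<times> real. (f\<^sub>1 (z \<bullet> (axis 2 1, 0) + 0))\<^sup>2
      + (f\<^sub>3 (z \<bullet> (axis 1 1, 0) + - (snd z * f\<^sub>1 (fst z $ 2))))\<^sup>2)"
    by (intro loc_integrable_add
          loc_integrable_periodic_profile[where p = "\<lambda>y. (f\<^sub>1 y)\<^sup>2", OF _ _ axis_Basis(2)]
          loc_integrable_periodic_profile[where p = "\<lambda>y. (f\<^sub>3 y)\<^sup>2", OF _ _ axis_Basis(2)])
       (auto simp: constant_along_def axis_def per1 per3 sq)
  then have L: "loc_integrable UNIV (\<lambda>z. (norm (shear_flow f\<^sub>1 f\<^sub>3 z))\<^sup>2)"
    by (simp add: power2_norm_vec3 shear_flow_nth inner_prod_def inner_axis)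
  have "loc_integrable UNIV (\<lambda>x::real^3. (f\<^sub>1 (x \<bullet> axis 2 1 + 0))\<^sup>2
      + (f\<^sub>3 (x \<bullet> axis 1 1 + - (t * f\<^sub>1 (x $ 2))))\<^sup>2)" for t
    by (intro loc_integrable_add
          loc_integrable_periodic_profile[where p = "\<lambda>y. (f\<^sub>1 y)\<^sup>2", OF _ _ axis_Basis(1)]
          loc_integrable_periodic_profile[where p = "\<lambda>y. (f\<^sub>3 y)\<^sup>2", OF _ _ axis_Basis(1)])
       (auto simp: constant_along_def axis_def per1 per3 sq)
  then have Lt: "loc_integrable UNIV (\<lambda>x. (norm (shear_flow f\<^sub>1 f\<^sub>3 (x, t)))\<^sup>2)" for t
    by (simp add: power2_norm_vec3 shear_flow_nth inner_axis)
  show "weak_Euler_solution Torus (shear_data u\<^sub>1 u\<^sub>3) (shear_flow u\<^sub>1 u\<^sub>3)"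
  proof (rule weak_Euler_solution_shear_flow[OF m1 m3 _ loc_integrable_subset[OF L] _ uf])
    show "loc_integrable UNIV (\<lambda>x. (norm (shear_data f\<^sub>1 f\<^sub>3 x))\<^sup>2)"
      "AE x in lborel. shear_data u\<^sub>1 u\<^sub>3 x = shear_data f\<^sub>1 f\<^sub>3 x"
      unfolding shear_data_eq_flow by (rule Lt ufs)+
    have "shear_flow u\<^sub>1 u\<^sub>3 (x + axis i 1, t) = shear_flow u\<^sub>1 u\<^sub>3 (x, t)" for x t i
      by (rule shear_flow_periodic) (simp_all add: per)
    then show "\<forall>t\<ge>0. descends Torus (\<lambda>x. shear_flow u\<^sub>1 u\<^sub>3 (x, t))"
      "descends Torus (shear_data u\<^sub>1 u\<^sub>3)"
      by (simp_all add: shear_data_eq_flow)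
  qed (simp_all add: per1 per3)
  have cell: "set_integrable lborel (cell Torus) (\<lambda>x. (norm (shear_flow f\<^sub>1 f\<^sub>3 (x, t)))\<^sup>2)" for t
    using Lt by (simp add: loc_integrable_def)
  have ae: "AE x in lborel. (norm (shear_flow u\<^sub>1 u\<^sub>3 (x, t)))\<^sup>2 = (norm (shear_flow f\<^sub>1 f\<^sub>3 (x, t)))\<^sup>2" for t
    using ufs[of t] by eventually_elim simp
  note leb = set_integral_lebesgue_AE[OF cell ae]
  show "set_integrable lebesgue (cell Torus) (\<lambda>x. (norm (shear_flow u\<^sub>1 u\<^sub>3 (x, t)))\<^sup>2)"
    by (rule leb)
  \<comment> \<open>At a fixed time the shear acts on space alone. Restricting to the cross-section
    keeps \<open>h\<close> periodic along the direction of shift, and shearing it by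
    \<open>?c\<close> replaces the flow by its initial data.\<close>
  let ?R = "cross_section Torus 1" and ?c = "\<lambda>x::real^3. t * f\<^sub>1 (x $ 2)"
  define h where "h x = indicator ?R x * (norm (shear_flow f\<^sub>1 f\<^sub>3 (x, t)))\<^sup>2" for x
  have ind: "indicator (cell Torus) x *\<^sub>R a = indicator (slab Torus (axis 1 1)) x *\<^sub>R (indicator ?R x * a)"
    for x and a :: real
    unfolding cell_eq[of Torus 1] by (simp add: indicator_inter_arith)
  have R: "indicator ?R (x + s *\<^sub>R axis 1 1) = (indicator ?R x :: real)"
    "indicator ?R (x + axis 1 1) = (indicator ?R x :: real)" for x s
    by (simp_all only: indicator_def constant_alongD[OF cross_section_constant(1)])
  have "(LINT x:cell Torus|lborel. (norm (shear_flow f\<^sub>1 f\<^sub>3 (x, t)))\<^sup>2)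
      = (LINT x:slab Torus (axis 1 1)|lborel. h x)"
    by (simp only: set_lebesgue_integral_def ind h_def)
  also have "\<dots> = (LINT x:slab Torus (axis 1 1)|lborel. h (x + ?c x *\<^sub>R axis 1 1))"
  proof (rule set_integral_shear[symmetric])
    have [measurable]: "(\<lambda>x. (norm (shear_flow f\<^sub>1 f\<^sub>3 (x, t)))\<^sup>2) \<in> borel_measurable borel"
      using Lt by (simp add: loc_integrable_def)
    show "h \<in> borel_measurable borel" unfolding h_def by measurable
    show "set_integrable lborel (slab Torus (axis 1 1)) h"
      using cell by (simp only: set_integrable_def ind h_def)
    show "periodic_along Torus (axis 1 1) h"
      by (simp add: periodic_along_def h_def R shear_flow_periodic per1 per3)
    show "constant_along (axis 1 1) ?c"
      by (simp add: constant_along_def axis_def)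
  qed (simp_all add: axis_Basis)
  also have "\<dots> = (LINT x:cell Torus|lborel. (norm (shear_data f\<^sub>1 f\<^sub>3 x))\<^sup>2)"
    by (simp only: set_lebesgue_integral_def ind h_def R shear_flow_along_flow)
  finally show "(LINT x:cell Torus|lebesgue. (norm (shear_flow u\<^sub>1 u\<^sub>3 (x, t)))\<^sup>2)
       = (LINT x:cell Torus|lebesgue. (norm (shear_data u\<^sub>1 u\<^sub>3 x))\<^sup>2)"
    unfolding shear_data_eq_flow using leb(2) by simp
qed

text \<open>Integrability of the squared norm accompanies constancy of the energy because the
  Bochner integral of a non-integrable function is zero by convention, which would make constancy
  alone too weak a claim.\<close>

theorem theorem2:
  fixes u\<^sub>1 u\<^sub>3 :: "real \<Rightarrow> real"
  shows "(L2_loc UNIV u\<^sub>1 \<and> L2_loc UNIV u\<^sub>3 \<and> L2_loc_spacetime Space (shear_flow u\<^sub>1 u\<^sub>3) \<longrightarrow>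
            weak_Euler_solution Space (shear_data u\<^sub>1 u\<^sub>3) (shear_flow u\<^sub>1 u\<^sub>3)) \<and>
         (L2_circle u\<^sub>1 \<and> L2_circle u\<^sub>3 \<longrightarrow>
            weak_Euler_solution Torus (shear_data u\<^sub>1 u\<^sub>3) (shear_flow u\<^sub>1 u\<^sub>3) \<and>
            (\<forall>t\<ge>0. set_integrable lebesgue (cell Torus) (\<lambda>x. (norm (shear_flow u\<^sub>1 u\<^sub>3 (x, t)))\<^sup>2)) \<and>
            (\<lambda>t. LINT x:cell Torus|lebesgue. (norm (shear_flow u\<^sub>1 u\<^sub>3 (x, t)))\<^sup>2) constant_on {0..})"
proof (intro conjI impI allI)
  assume "L2_loc UNIV u\<^sub>1 \<and> L2_loc UNIV u\<^sub>3 \<and> L2_loc_spacetime Space (shear_flow u\<^sub>1 u\<^sub>3)"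
  then show "weak_Euler_solution Space (shear_data u\<^sub>1 u\<^sub>3) (shear_flow u\<^sub>1 u\<^sub>3)"
    by (intro weak_Euler_solution_space) auto
next
  assume "L2_circle u\<^sub>1 \<and> L2_circle u\<^sub>3"
  then have u: "L2_circle u\<^sub>1" "L2_circle u\<^sub>3" by auto
  show "weak_Euler_solution Torus (shear_data u\<^sub>1 u\<^sub>3) (shear_flow u\<^sub>1 u\<^sub>3)"
    by (rule shear_flow_torus(1)[OF u])
  show "set_integrable lebesgue (cell Torus) (\<lambda>x. (norm (shear_flow u\<^sub>1 u\<^sub>3 (x, t)))\<^sup>2)" for t
    by (rule shear_flow_torus(2)[OF u])
  show "(\<lambda>t. LINT x:cell Torus|lebesgue. (norm (shear_flow u\<^sub>1 u\<^sub>3 (x, t)))\<^sup>2) constant_on {0..}"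
    unfolding constant_on_def using shear_flow_torus(3)[OF u] by blast
qed

end
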